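(* Let $b>1$ be a constant. There exists a constant $\tau_0=\tau_0(b)>0$ such that for every $0<\tau<\tau_0$ there exist infinitely many interior $C^1$ smooth transonic solutions of $$\Big(1-\frac1{\rho^2}\Big)\rho_x=\rho E-\frac1\tau,\qquad E_x=\rho-b\quad (x\in(0,1)),\qquad \rho(0)=\rho(1)=1,$$ of the form $$\rho(x)=\begin{cases}\rho_{sup}(x),&x\in(0,x_0),\\ \rho_{sub}(x),&x\in(x_0,1),\end{cases}$$ where $x_0\in(0,1)$ is the location of transition, $0<\rho_{sup}\le1$ and $\rho_{sub}\ge1$ satisfy $$\rho_{sup}(x_0)=\rho_{sub}(x_0)=1,$$ $$(\rho_{sup})_x(x_0)=(\rho_{sub})_x(x_0)=\frac14\Big(\frac1\tau-\sqrt{\frac1{\tau^2}-8(b-1)}\Big),\qquad E_{sup}(x_0)=E_{sub}(x_0)=\frac1\tau.$$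
   Context: $C^1$ transonic solution: a positive function $\rho\in C^1(0,1)$ with $\rho(0)=\rho(1)=1$ for which there is $x_0\in(0,1)$ such that $\rho=\rho_{sup}$ with $0<\rho_{sup}\le1$ on $(0,x_0)$, $\rho=\rho_{sub}$ with $\rho_{sub}\ge1$ on $(x_0,1)$, $\rho_{sup}(x_0)=\rho_{sub}(x_0)$ and $\rho_{sup}'(x_0)=\rho_{sub}'(x_0)$. It is understood that on each of $(0,x_0)$ and $(x_0,1)$ the pair $(\rho,E)$ satisfies the differential equations, where $(\rho-1)^2$ is in $H^1$ of the piece, $\rho$ is continuous up to the endpoints of the piece, the first equation is understood as $E=\frac{(\rho+1)[(\rho-1)^2]_x}{2\rho^3}+\frac1{\tau\rho}$ and $E_x=\rho-b$ holds a.e.; $E_{sup}$ and $E_{sub}$ denote $E$ on the two pieces. *)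

theory Defs
  imports "HOL-Analysis.Analysis"
begin

definition test_function :: "real set \<Rightarrow> (real \<Rightarrow> real) \<Rightarrow> bool" where
  "test_function S \<phi> \<longleftrightarrow>
     (\<forall>n x. (deriv ^^ n) \<phi> differentiable (at x)) \<and>
     (\<exists>K. compact K \<and> K \<subseteq> S \<and> (\<forall>x. x \<notin> K \<longrightarrow> \<phi> x = 0))"

definition locally_integrable :: "real set \<Rightarrow> (real \<Rightarrow> real) \<Rightarrow> bool" where
  "locally_integrable S u \<longleftrightarrow>
     (\<forall>K. compact K \<and> K \<subseteq> S \<longrightarrow> set_integrable lebesgue K u)"

text \<open>\<open>g\<close> is the distributional derivative of \<open>u\<close> on the open set \<open>S\<close>. Local integrability
  is required explicitly because the integral of a non-integrable function is \<open>0\<close> by convention.\<close>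
definition has_weak_derivative :: "(real \<Rightarrow> real) \<Rightarrow> (real \<Rightarrow> real) \<Rightarrow> real set \<Rightarrow> bool" where
  "has_weak_derivative u g S \<longleftrightarrow>
     locally_integrable S u \<and> locally_integrable S g \<and>
     (\<forall>\<phi>. test_function S \<phi> \<longrightarrow>
        (LINT x:S|lebesgue. u x * deriv \<phi> x) = - (LINT x:S|lebesgue. g x * \<phi> x))"

definition in_L2 :: "real set \<Rightarrow> (real \<Rightarrow> real) \<Rightarrow> bool" where
  "in_L2 S u \<longleftrightarrow>
     set_borel_measurable lebesgue S u \<and> set_integrable lebesgue S (\<lambda>x. (u x)\<^sup>2)"

definition in_H1 :: "real set \<Rightarrow> (real \<Rightarrow> real) \<Rightarrow> bool" where
  "in_H1 S u \<longleftrightarrow> in_L2 S u \<and> (\<exists>g. in_L2 S g \<and> has_weak_derivative u g S)"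

text \<open>The pair \<open>(\<rho>, E)\<close> solves the system on the piece \<open>(l, r)\<close>. The function \<open>w\<close> is the weak
  derivative of \<open>(\<rho> - 1)\<^sup>2\<close>; by \<open>(1 - 1/\<rho>\<^sup>2) \<rho>\<^sub>x = (\<rho> + 1) [(\<rho> - 1)\<^sup>2]\<^sub>x / (2 \<rho>\<^sup>2)\<close> the last
  formula is the momentum equation solved for \<open>E\<close>. A function on an interval whose weak derivative
  is bounded has a unique representative that is continuous up to the endpoints; \<open>E\<close> denotes this
  representative, which gives the value of \<open>E\<close> at an endpoint a meaning.\<close>
definition solves_on_piece ::
    "real \<Rightarrow> real \<Rightarrow> real \<Rightarrow> real \<Rightarrow> (real \<Rightarrow> real) \<Rightarrow> (real \<Rightarrow> real) \<Rightarrow> bool" where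
  "solves_on_piece b \<tau> l r \<rho> E \<longleftrightarrow>
     continuous_on {l..r} \<rho> \<and> continuous_on {l..r} E \<and>
     in_H1 {l<..<r} (\<lambda>x. (\<rho> x - 1)\<^sup>2) \<and>
     (\<exists>w. has_weak_derivative (\<lambda>x. (\<rho> x - 1)\<^sup>2) w {l<..<r} \<and>
        (AE x in lebesgue. x \<in> {l<..<r} \<longrightarrow>
           E x = (\<rho> x + 1) * w x / (2 * \<rho> x ^ 3) + 1 / (\<tau> * \<rho> x))) \<and>
     (\<exists>E'. has_weak_derivative E E' {l<..<r} \<and>
        (AE x in lebesgue. x \<in> {l<..<r} \<longrightarrow> E' x = \<rho> x - b))"

text \<open>\<open>\<rho>\<close> is a \<open>C\<^sup>1\<close> transonic solution with transition location \<open>x0\<close>, supersonic piece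
  \<open>(\<rho>sup, Esup)\<close> on \<open>[0, x0]\<close> and subsonic piece \<open>(\<rho>sub, Esub)\<close> on \<open>[x0, 1]\<close>. Derivatives of
  the pieces at \<open>x0\<close> are one-sided. Continuity of \<open>\<rho>\<close> on the closed interval makes the boundary
  conditions refer to the limits of \<open>\<rho>\<close> at \<open>0\<close> and \<open>1\<close>.\<close>
definition C1_transonic_solution ::
    "real \<Rightarrow> real \<Rightarrow> (real \<Rightarrow> real) \<Rightarrow> real \<Rightarrow> (real \<Rightarrow> real) \<Rightarrow> (real \<Rightarrow> real) \<Rightarrow>
     (real \<Rightarrow> real) \<Rightarrow> (real \<Rightarrow> real) \<Rightarrow> bool" where
  "C1_transonic_solution b \<tau> \<rho> x0 \<rho>sup \<rho>sub Esup Esub \<longleftrightarrow>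
     (\<forall>x\<in>{0<..<1}. 0 < \<rho> x) \<and> \<rho> C1_differentiable_on {0<..<1} \<and>
     continuous_on {0..1} \<rho> \<and> \<rho> 0 = 1 \<and> \<rho> 1 = 1 \<and>
     x0 \<in> {0<..<1} \<and>
     (\<forall>x\<in>{0<..<x0}. \<rho> x = \<rho>sup x \<and> 0 < \<rho>sup x \<and> \<rho>sup x \<le> 1) \<and>
     (\<forall>x\<in>{x0<..<1}. \<rho> x = \<rho>sub x \<and> 1 \<le> \<rho>sub x) \<and>
     \<rho>sup x0 = \<rho>sub x0 \<and>
     (\<exists>d. (\<rho>sup has_real_derivative d) (at x0 within {0..x0}) \<and>
          (\<rho>sub has_real_derivative d) (at x0 within {x0..1})) \<and>
     solves_on_piece b \<tau> 0 x0 \<rho>sup Esup \<and>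
     solves_on_piece b \<tau> x0 1 \<rho>sub Esub"

end

theory Submission
  imports Defs
begin

text \<open>
  Fix \<open>x\<^sub>0\<close> and look at one piece at a time, writing \<open>x = x\<^sub>0 + \<sigma> y\<close> with \<open>\<sigma> = 1\<close> (subsonic) or
  \<open>\<sigma> = -1\<close> (supersonic), \<open>\<rho> = 1/(1 - \<sigma> f)\<close> and \<open>E = 1/\<tau> - \<sigma> q\<close>. With \<open>K\<close> the primitive of
  \<open>(1 - 1/\<rho>\<^sup>2)/\<rho>\<close> and \<open>h = K(f)\<close>, both pieces become \<open>h' = f/\<tau> - q\<close>, \<open>q' = b - \<rho>\<close>,
  \<open>q(0) = 0\<close>, \<open>h(0) = h(L) = 0\<close>. For given \<open>q\<close> the first equation is solved backwards from
  \<open>h(L) = 0\<close>; there its right-hand side is dissipative, which compensates for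
  \<open>f = K\<^sup>-\<^sup>1(h) \<sim> \<surd>h\<close> not being Lipschitz. The dissipation gives \<open>\<integral>\<bar>\<delta>f\<bar> \<le> \<tau> \<integral>\<bar>\<delta>q\<bar>\<close>, so the map
  \<open>q \<mapsto> \<integral> (b - \<rho>)\<close> is a contraction for small \<open>\<tau>\<close>, while the barrier \<open>f \<le> 2 b \<tau> y\<close> forces
  \<open>h(0) = 0\<close>. The sonic point is a node whose slopes are the two roots of
  \<open>2 p\<^sup>2 - p/\<tau> + (b - 1) = 0\<close>; as \<open>y \<rightarrow> 0\<close> the quotient \<open>f/y\<close> is driven to the smaller root,
  because it stays below the larger one. Since this works for every \<open>x\<^sub>0 \<in> (0,1)\<close>, there are
  infinitely many solutions.\<close>

section \<open>Scalar equations with a monotone right-hand side\<close>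

text \<open>Banach's theorem in the supremum norm, carried out as Picard iteration: functions are
  total, so only their values on \<open>X\<close> are controlled and equality is obtained only
  there. The closed sets \<open>C x\<close> carry pointwise constraints to the uniform
  limit.\<close>

lemma continuous_fixed_point:
  fixes X :: "'a::topological_space set" and C :: "'a \<Rightarrow> real set" and T :: "('a \<Rightarrow> real) \<Rightarrow> 'a \<Rightarrow> real"
  defines "S \<equiv> {u. continuous_on X u \<and> (\<forall>x\<in>X. u x \<in> C x)}"
  assumes X: "compact X" and c: "0 \<le> c" "c < 1"
    and C: "\<And>x. x \<in> X \<Longrightarrow> closed (C x)"
    and u0: "u0 \<in> S" and T: "\<And>u. u \<in> S \<Longrightarrow> T u \<in> S"
    and contr: "\<And>u v d x. u \<in> S \<Longrightarrow> v \<in> S \<Longrightarrow> (\<And>x. x \<in> X \<Longrightarrow> \<bar>u x - v x\<bar> \<le> d) \<Longrightarrow> x \<in> X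
                  \<Longrightarrow> \<bar>T u x - T v x\<bar> \<le> c * d"
  shows "\<exists>u\<in>S. \<forall>x\<in>X. T u x = u x"
proof -
  define u where "u n = (T ^^ n) u0" for n
  have uS: "u n \<in> S" for n
    unfolding u_def by (induction n) (auto simp: u0 T)
  have u_Suc: "u (Suc n) = T (u n)" for n
    by (simp add: u_def)
  have cont: "continuous_on X (u n)" for n
    using uS by (auto simp: S_def)
  have "compact ((\<lambda>x. u 1 x - u 0 x) ` X)"
    by (intro compact_continuous_image continuous_intros cont X)
  then obtain d where d: "\<And>x. x \<in> X \<Longrightarrow> \<bar>u 1 x - u 0 x\<bar> \<le> d"
    using bounded_iff[of "(\<lambda>x. u 1 x - u 0 x) ` X"] compact_imp_bounded by auto
  have step: "\<bar>u (Suc n) x - u n x\<bar> \<le> c ^ n * d" if "x \<in> X" for n x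
    using that
  proof (induction n arbitrary: x)
    case 0
    then show ?case using d by simp
  next
    case (Suc n)
    show ?case
      using contr[OF uS uS Suc.IH Suc.prems] by (simp add: u_Suc mult.assoc)
  qed
  define v where "v x = u 0 x + (\<Sum>n. u (Suc n) x - u n x)" for x
  have "uniform_limit X (\<lambda>n x. \<Sum>i<n. u (Suc i) x - u i x) (\<lambda>x. \<Sum>n. u (Suc n) x - u n x) sequentially"
    by (rule Weierstrass_m_test[where M = "\<lambda>n. c ^ n * d"])
      (use c step in \<open>auto intro!: summable_mult2 summable_geometric\<close>)
  then have "uniform_limit X (\<lambda>n x. u 0 x + (\<Sum>i<n. u (Suc i) x - u i x)) v sequentially"
    unfolding v_def by (intro uniform_limit_intros)
  then have lim: "uniform_limit X u v sequentially"
    using sum_lessThan_telescope[of "\<lambda>i. u i x" for x] by simp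
  have pw: "(\<lambda>n. u n x) \<longlonglongrightarrow> v x" if "x \<in> X" for x
    using tendsto_uniform_limitI[OF lim that] .
  have vS: "v \<in> S"
    unfolding S_def
  proof (intro CollectI conjI ballI)
    show "continuous_on X v"
      by (rule uniform_limit_theorem[OF _ lim]) (auto simp: cont)
    show "v x \<in> C x" if "x \<in> X" for x
      by (rule closed_sequentially[OF C[OF that] _ pw[OF that]]) (use uS that in \<open>auto simp: S_def\<close>)
  qed
  have "T v x = v x" if x: "x \<in> X" for x
  proof -
    have "(\<lambda>n. T (u n) x) \<longlonglongrightarrow> T v x"
    proof (rule tendstoI)
      fix e :: real assume e: "e > 0"
      from lim e have "\<forall>\<^sub>F n in sequentially. \<forall>x\<in>X. dist (u n x) (v x) < e"
        by (rule uniform_limitD)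
      then show "\<forall>\<^sub>F n in sequentially. dist (T (u n) x) (T v x) < e"
      proof eventually_elim
        case (elim n)
        have "\<bar>T (u n) x - T v x\<bar> \<le> c * e"
          by (rule contr[OF uS vS _ x]) (use elim in \<open>force simp: dist_real_def\<close>)
        also have "\<dots> < e"
          using c e by simp
        finally show ?case by (simp add: dist_real_def)
      qed
    qed
    moreover have "(\<lambda>n. T (u n) x) \<longlonglongrightarrow> v x"
      using LIMSEQ_Suc[OF pw[OF x]] by (simp add: u_Suc)
    ultimately show ?thesis
      using LIMSEQ_unique by blast
  qed
  with vS show ?thesis by blast
qed

text \<open>Subtract the line \<open>D * (t - a)\<close> and go back from \<open>x\<close> to the
  last point where the difference \<open>k\<close> is nonpositive: after it \<open>g\<close> is
  positive, so the mean value theorem contradicts the bound on \<open>g'\<close>. A bound required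
  only where \<open>g > 0\<close> is what monotonicity provides for the difference of two
  solutions.\<close>

lemma growth_bound_where_positive:
  fixes g :: "real \<Rightarrow> real"
  assumes der: "\<And>x. x \<in> {a..c} \<Longrightarrow> (g has_real_derivative g' x) (at x within {a..c})"
    and "g a \<le> 0" and g': "\<And>x. x \<in> {a..c} \<Longrightarrow> g x > 0 \<Longrightarrow> g' x \<le> D" and "0 \<le> D" and x: "x \<in> {a..c}"
  shows "g x \<le> D * (x - a)"
proof (rule ccontr)
  define k where "k t = g t - D * (t - a)" for t
  assume "\<not> ?thesis"
  then have kx: "k x > 0" by (simp add: k_def)
  have der_k: "(k has_real_derivative g' t - D) (at t within {a..c})" if "t \<in> {a..c}" for t
    unfolding k_def by (rule derivative_eq_intros der that refl | simp)+
  have cont: "continuous_on {a..x} k"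
    using DERIV_continuous_on[OF der_k] continuous_on_subset x by fastforce
  have "compact {t \<in> {a..x}. k t \<le> 0}"
    using continuous_closed_preimage[OF cont, of "{..0}"]
    by (auto simp: compact_eq_bounded_closed vimage_def Int_def intro: bounded_subset[of "{a..x}"])
  moreover have "a \<in> {t \<in> {a..x}. k t \<le> 0}"
    using assms by (auto simp: k_def)
  ultimately obtain z where z: "z \<in> {a..x}" "k z \<le> 0" and zmax: "\<And>t. t \<in> {a..x} \<Longrightarrow> k t \<le> 0 \<Longrightarrow> t \<le> z"
    using compact_attains_sup[of "{t \<in> {a..x}. k t \<le> 0}"] by blast
  have "z < x" using z kx by (cases "z = x") auto
  have sub: "{z..x} \<subseteq> {a..c}" using z x by auto
  obtain t where t: "t \<in> {z<..<x}" "k x - k z = (g' t - D) * (x - z)"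
    using mvt_simple[OF \<open>z < x\<close>, of k "\<lambda>t h. (g' t - D) * h"] der_k sub
    by (metis (no_types, lifting) atLeastAtMost_iff has_field_derivative_def has_field_derivative_subset in_mono)
  have "k t > 0" using zmax[of t] t z by force
  moreover have "0 \<le> D * (t - a)" using t z \<open>0 \<le> D\<close> by simp
  ultimately have "g t > 0" by (simp add: k_def)
  then have "(g' t - D) * (x - z) \<le> 0"
    using g'[of t] t sub by (intro mult_nonpos_nonneg) auto
  with t kx z show False by simp
qed

text \<open>Variation of constants with the factor \<open>exp (\<Lambda> * y)\<close> leaves
  \<open>\<Lambda> * u - G u\<close> as the integrand. The weight makes the Picard map a contraction
  on all of \<open>{0..L}\<close> at once, with constant
  \<open>1 - exp (- \<Lambda> * L)\<close>.\<close>

lemma lipschitz_monotone_ode_exists: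
  fixes G q :: "real \<Rightarrow> real"
  assumes L: "0 \<le> L" and Lam: "\<Lambda> > 0" and mono: "mono G"
    and lip: "\<And>u v. \<bar>G u - G v\<bar> \<le> \<Lambda> * \<bar>u - v\<bar>"
    and q: "continuous_on {0..L} q"
  shows "\<exists>h. h 0 = 0 \<and> (\<forall>y\<in>{0..L}. (h has_real_derivative q y - G (h y)) (at y within {0..L}))"
proof -
  define g where "g h s = exp (\<Lambda> * s) * (q s + \<Lambda> * h s - G (h s))" for h s
  define T where "T h y = exp (- \<Lambda> * y) * integral {0..y} (g h)" for h y
  define S :: "(real \<Rightarrow> real) set" where "S = {u. continuous_on {0..L} u \<and> (\<forall>x\<in>{0..L}. u x \<in> UNIV)}"
  have "\<Lambda>-lipschitz_on UNIV G"
    using lip Lam by (intro lipschitz_onI) (auto simp: dist_real_def)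
  then have contG: "continuous_on UNIV G"
    by (rule lipschitz_on_continuous_on)
  have cont_g: "continuous_on {0..L} (g h)" if "h \<in> S" for h
    unfolding g_def using that q
    by (intro continuous_intros continuous_on_compose2[OF contG]) (auto simp: S_def)
  have der_T: "(T h has_real_derivative q y + \<Lambda> * h y - G (h y) - \<Lambda> * T h y) (at y within {0..L})"
    if h: "h \<in> S" and y: "y \<in> {0..L}" for h y
  proof -
    have "((\<lambda>y. integral {0..y} (g h)) has_real_derivative g h y) (at y within {0..L})"
      by (rule integral_has_real_derivative[OF cont_g[OF h] y])
    then show ?thesis
      unfolding T_def
      by (auto intro!: derivative_eq_intros simp: g_def algebra_simps exp_minus)
  qed
  have contr: "\<bar>T u y - T v y\<bar> \<le> (1 - exp (- \<Lambda> * L)) * d"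
    if uv: "u \<in> S" "v \<in> S" and d: "\<And>x. x \<in> {0..L} \<Longrightarrow> \<bar>u x - v x\<bar> \<le> d" and y: "y \<in> {0..L}" for u v d y
  proof -
    have "0 \<le> d" using d[OF y] by simp
    have int: "g h integrable_on {0..y}" if "h \<in> S" for h
      by (rule integrable_continuous_interval[OF continuous_on_subset[OF cont_g[OF that]]]) (use y in auto)
    have le: "norm (g u s - g v s) \<le> \<Lambda> * exp (\<Lambda> * s) * d" if s: "s \<in> {0..y}" for s
    proof -
      \<comment> \<open>Monotonicity makes the two differences partly cancel, so the Lipschitz
        constant stays \<Lambda>. The crude constant \<open>2 * \<Lambda>\<close> would not give a
        contraction on long intervals.\<close>
      have "\<bar>\<Lambda> * (u s - v s) - (G (u s) - G (v s))\<bar> \<le> \<Lambda> * \<bar>u s - v s\<bar>"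
      proof (cases "v s \<le> u s")
        case True
        then have "G (v s) \<le> G (u s)" using mono by (rule monoD[rotated])
        with lip[of "u s" "v s"] True show ?thesis by (simp add: algebra_simps)
      next
        case False
        then have "G (u s) \<le> G (v s)" using mono by (intro monoD[of G]) auto
        with lip[of "u s" "v s"] False show ?thesis by (simp add: algebra_simps)
      qed
      also have "\<dots> \<le> \<Lambda> * d" using d[of s] s y Lam by auto
      finally have "exp (\<Lambda> * s) * \<bar>\<Lambda> * (u s - v s) - (G (u s) - G (v s))\<bar> \<le> exp (\<Lambda> * s) * (\<Lambda> * d)"
        by simp
      moreover have "g u s - g v s = exp (\<Lambda> * s) * (\<Lambda> * (u s - v s) - (G (u s) - G (v s)))"
        by (simp add: g_def algebra_simps)
      ultimately show ?thesis by (simp add: abs_mult mult_ac)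
    qed
    have ftc: "((\<lambda>s. \<Lambda> * exp (\<Lambda> * s) * d) has_integral exp (\<Lambda> * y) * d - exp (\<Lambda> * 0) * d) {0..y}"
      by (rule fundamental_theorem_of_calculus)
        (use y in \<open>auto intro!: derivative_eq_intros simp flip: has_real_derivative_iff_has_vector_derivative\<close>)
    have "norm (integral {0..y} (\<lambda>s. g u s - g v s)) \<le> integral {0..y} (\<lambda>s. \<Lambda> * exp (\<Lambda> * s) * d)"
      using ftc le int uv by (intro integral_norm_bound_integral integrable_diff) (auto simp: integrable_on_def)
    also have "\<dots> = (exp (\<Lambda> * y) - 1) * d"
      unfolding integral_unique[OF ftc] by (simp add: algebra_simps)
    finally have "\<bar>integral {0..y} (g u) - integral {0..y} (g v)\<bar> \<le> (exp (\<Lambda> * y) - 1) * d"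
      using int uv by (simp add: integral_diff)
    then have "exp (- \<Lambda> * y) * \<bar>integral {0..y} (g u) - integral {0..y} (g v)\<bar>
        \<le> exp (- \<Lambda> * y) * ((exp (\<Lambda> * y) - 1) * d)"
      by (rule mult_left_mono) simp
    also have "\<dots> = (1 - exp (- \<Lambda> * y)) * d"
      by (simp add: algebra_simps exp_minus)
    also have "\<dots> \<le> (1 - exp (- \<Lambda> * L)) * d"
      using y Lam \<open>0 \<le> d\<close> by (intro mult_right_mono) auto
    finally show ?thesis
      by (simp add: T_def abs_mult flip: right_diff_distrib)
  qed
  have TS: "T h \<in> S" if "h \<in> S" for h
    using DERIV_continuous_on[OF der_T[OF that]] by (simp add: S_def)
  have "\<exists>h\<in>S. \<forall>y\<in>{0..L}. T h y = h y"
    unfolding S_def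
    by (rule continuous_fixed_point[where c = "1 - exp (- \<Lambda> * L)" and ?u0.0 = "\<lambda>_. 0"])
      (use Lam L TS contr in \<open>auto simp: S_def\<close>)
  then obtain h where h: "h \<in> S" "\<And>y. y \<in> {0..L} \<Longrightarrow> T h y = h y" by blast
  have "(h has_real_derivative q y - G (h y)) (at y within {0..L})" if y: "y \<in> {0..L}" for y
  proof -
    have "(T h has_real_derivative q y - G (h y)) (at y within {0..L})"
      using der_T[OF h(1) y] h(2)[OF y] by simp
    then show ?thesis
      by (rule has_field_derivative_transform_within[OF _ zero_less_one y]) (use h(2) in auto)
  qed
  moreover have "h 0 = 0"
    using h(2)[of 0] L by (simp add: T_def)
  ultimately show ?thesis by blast
qed

text \<open>\<open>F\<close> need not be Lipschitz at \<open>0\<close>; it is approximated by \<open>\<lambda>u. F (max u \<epsilon>)\<close>, and monotonicity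
  makes the approximate solutions converge uniformly.\<close>
lemma monotone_ode_exists:
  fixes F q :: "real \<Rightarrow> real"
  assumes L: "0 \<le> L" and mono: "mono F" and F: "uniformly_continuous_on UNIV F" "\<And>u. u \<le> 0 \<Longrightarrow> F u = 0"
    and lip: "\<And>\<epsilon>. \<epsilon> > 0 \<Longrightarrow> \<exists>\<Lambda>>0. \<forall>u\<ge>\<epsilon>. \<forall>v\<ge>\<epsilon>. \<bar>F u - F v\<bar> \<le> \<Lambda> * \<bar>u - v\<bar>"
    and q: "continuous_on {0..L} q"
  shows "\<exists>h. h 0 = 0 \<and> (\<forall>y\<in>{0..L}. (h has_real_derivative q y - F (h y)) (at y within {0..L}))"
proof -
  define e :: "nat \<Rightarrow> real" where "e n = 1 / Suc n" for n
  have e: "e n > 0" for n by (simp add: e_def)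
  define G where "G n u = F (max u (e n))" for n u
  have Gmono: "mono (G n)" for n
    unfolding G_def by (intro monoI monoD[OF mono]) auto
  have "\<exists>h. h 0 = 0 \<and> (\<forall>y\<in>{0..L}. (h has_real_derivative q y - G n (h y)) (at y within {0..L}))" for n
  proof -
    obtain \<Lambda> where \<Lambda>: "\<Lambda> > 0" "\<And>u v. u \<ge> e n \<Longrightarrow> v \<ge> e n \<Longrightarrow> \<bar>F u - F v\<bar> \<le> \<Lambda> * \<bar>u - v\<bar>"
      using lip[OF e] by blast
    show ?thesis
    proof (rule lipschitz_monotone_ode_exists[OF L \<Lambda>(1) Gmono _ q])
      fix u v
      have "\<bar>G n u - G n v\<bar> \<le> \<Lambda> * \<bar>max u (e n) - max v (e n)\<bar>"
        unfolding G_def by (rule \<Lambda>(2)) auto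
      also have "\<dots> \<le> \<Lambda> * \<bar>u - v\<bar>"
        using \<Lambda>(1) by (intro mult_left_mono) auto
      finally show "\<bar>G n u - G n v\<bar> \<le> \<Lambda> * \<bar>u - v\<bar>" .
    qed
  qed
  then obtain h where h0: "\<And>n. h n 0 = 0"
    and h: "\<And>n y. y \<in> {0..L} \<Longrightarrow> (h n has_real_derivative q y - G n (h n y)) (at y within {0..L})"
    by metis
  have F_nonneg: "0 \<le> F u" for u
    using monoD[OF mono, of "min u 0" u] F(2)[of "min u 0"] by simp
  \<comment> \<open>The truncated value is either \<open>F u\<close> or \<open>F (e n)\<close>, so
    the truncation error is uniform in \<open>u\<close>.\<close>
  have GF: "F u \<le> G n u" "G n u \<le> F u + F (e n)" for n u
    using monoD[OF mono, of u "max u (e n)"] F_nonneg[of u] F_nonneg[of "e n"]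
    by (auto simp: G_def max_def)
  have e0: "e \<longlonglongrightarrow> 0"
    unfolding e_def using LIMSEQ_inverse_real_of_nat by (simp add: inverse_eq_divide)
  have "isCont F 0"
    using uniformly_continuous_imp_continuous[OF F(1)] by (simp add: continuous_on_eq_continuous_at)
  then have "(\<lambda>n. F (e n)) \<longlonglongrightarrow> F 0"
    using e0 by (rule isCont_tendsto_compose)
  then have Fe: "(\<lambda>n. F (e n)) \<longlonglongrightarrow> 0"
    using F(2)[of 0] by simp
  \<comment> \<open>Where \<open>h m > h n\<close>, monotonicity cancels the main terms and leaves
    only the truncation error of index \<open>n\<close>; exchanging \<open>m\<close> and
    \<open>n\<close> gives the other half of the Cauchy estimate.\<close>
  have diff: "h m y - h n y \<le> F (e n) * L" if y: "y \<in> {0..L}" for m n y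
  proof -
    have "h m y - h n y \<le> F (e n) * (y - 0)"
    proof (rule growth_bound_where_positive[OF _ _ _ _ y])
      show "((\<lambda>y. h m y - h n y) has_real_derivative (q y - G m (h m y)) - (q y - G n (h n y))) (at y within {0..L})"
        if "y \<in> {0..L}" for y by (intro derivative_intros h that)
      show "(q y - G m (h m y)) - (q y - G n (h n y)) \<le> F (e n)" if "h m y - h n y > 0" for y
        using GF(1)[of "h m y" m] GF(2)[of n "h n y"] monoD[OF mono, of "h n y" "h m y"] that by simp
    qed (auto simp: h0 F_nonneg)
    also have "\<dots> \<le> F (e n) * L" using y F_nonneg by (intro mult_left_mono) auto
    finally show ?thesis .
  qed
  have "uniformly_Cauchy_on {0..L} h"
  proof (rule uniformly_Cauchy_onI)
    fix r :: real assume r: "r > 0"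
    have "(\<lambda>n. F (e n) * L) \<longlonglongrightarrow> 0"
      using tendsto_mult_right[OF Fe, of L] by simp
    then have "\<forall>\<^sub>F n in sequentially. F (e n) * L < r"
      using r by (rule order_tendstoD)
    then obtain N where N: "\<And>n. n \<ge> N \<Longrightarrow> F (e n) * L < r"
      by (auto simp: eventually_sequentially)
    have "dist (h m y) (h n y) < r" if "y \<in> {0..L}" "m \<ge> N" "n \<ge> N" for m n y
      using diff[OF that(1), of m n] diff[OF that(1), of n m] N[OF that(2)] N[OF that(3)]
      by (simp add: dist_real_def abs_less_iff)
    then show "\<exists>M. \<forall>x\<in>{0..L}. \<forall>m\<ge>M. \<forall>n\<ge>M. dist (h m x) (h n x) < r" by blast
  qed
  then obtain k where lim: "uniform_limit {0..L} h k sequentially"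
    using Cauchy_uniformly_convergent uniformly_convergent_on_def by blast
  have pw: "(\<lambda>n. h n y) \<longlonglongrightarrow> k y" if "y \<in> {0..L}" for y
    using tendsto_uniform_limitI[OF lim that] .
  have lim_F: "uniform_limit {0..L} (\<lambda>n y. F (h n y)) (\<lambda>y. F (k y)) sequentially"
    by (rule uniform_limit_compose_uniformly_continuous_on[OF lim F(1)]) auto
  have lim_G: "\<forall>\<^sub>F n in sequentially. \<forall>y\<in>{0..L}. \<bar>F (k y) - G n (h n y)\<bar> \<le> r" if r: "r > 0" for r
  proof -
    have "\<forall>\<^sub>F n in sequentially. \<forall>y\<in>{0..L}. dist (F (h n y)) (F (k y)) < r / 2"
      using uniform_limitD[OF lim_F, of "r / 2"] r by simp
    moreover have "\<forall>\<^sub>F n in sequentially. F (e n) < r / 2"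
      using order_tendstoD(2)[OF Fe, of "r / 2"] r by simp
    ultimately show ?thesis
    proof eventually_elim
      case (elim n)
      show ?case
      proof
        fix y assume "y \<in> {0..L}"
        then have "\<bar>F (h n y) - F (k y)\<bar> < r / 2" using elim(1) by (auto simp: dist_real_def)
        then show "\<bar>F (k y) - G n (h n y)\<bar> \<le> r"
          using GF(1)[of "h n y" n] GF(2)[of n "h n y"] elim(2) by linarith
      qed
    qed
  qed
  \<comment> \<open>The derivatives converge uniformly, which transfers the equation to the limit.
    The limit \<open>g\<close> obtained here is identified with the uniform limit \<open>k\<close>
    afterwards.\<close>
  have "\<exists>g. \<forall>y\<in>{0..L}. (\<lambda>n. h n y) \<longlonglongrightarrow> g y \<and>
          (g has_derivative (*) (q y - F (k y))) (at y within {0..L})"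
  proof (rule has_derivative_sequence)
    show "(h n has_derivative (*) (q y - G n (h n y))) (at y within {0..L})" if "y \<in> {0..L}" for n y
      using h[OF that] by (simp add: has_field_derivative_def)
    show "\<forall>\<^sub>F n in sequentially. \<forall>y\<in>{0..L}. \<forall>z.
        norm ((q y - G n (h n y)) * z - (q y - F (k y)) * z) \<le> r * norm z" if "r > 0" for r
      using lim_G[OF that]
    proof eventually_elim
      case (elim n)
      have "norm ((q y - G n (h n y)) * z - (q y - F (k y)) * z) = \<bar>F (k y) - G n (h n y)\<bar> * norm z" for y z
        by (simp add: algebra_simps flip: abs_mult)
      then show ?case using elim by (auto intro: mult_right_mono)
    qed
    show "0 \<in> {0..L}" "(\<lambda>n. h n 0) \<longlonglongrightarrow> 0" using L by (simp_all add: h0)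
  qed auto
  then obtain g where g: "\<And>y. y \<in> {0..L} \<Longrightarrow> (\<lambda>n. h n y) \<longlonglongrightarrow> g y"
    "\<And>y. y \<in> {0..L} \<Longrightarrow> (g has_real_derivative q y - F (k y)) (at y within {0..L})"
    unfolding has_field_derivative_def by blast
  have "k y = g y" if "y \<in> {0..L}" for y
    using LIMSEQ_unique g(1) pw that by blast
  moreover have "g 0 = 0"
    using LIMSEQ_unique[OF g(1)[of 0], of 0] L by (simp add: h0)
  ultimately show ?thesis
    using g(2) by auto
qed

text \<open>Reflecting \<open>x\<close> to \<open>L - x\<close> turns this into the growth bound
  with \<open>D = 0\<close>: a function that cannot decrease while positive cannot come down to a
  nonpositive end value.\<close>

lemma backward_nonpos:
  fixes g :: "real \<Rightarrow> real"
  assumes der: "\<And>x. x \<in> {0..L} \<Longrightarrow> (g has_real_derivative g' x) (at x within {0..L})"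
    and "g L \<le> 0" and g': "\<And>x. x \<in> {0..L} \<Longrightarrow> g x > 0 \<Longrightarrow> 0 \<le> g' x" and x: "x \<in> {0..L}"
  shows "g x \<le> 0"
proof -
  have "g (L - (L - x)) \<le> 0 * (L - x - 0)"
  proof (rule growth_bound_where_positive[where g = "\<lambda>y. g (L - y)" and a = 0 and c = L])
    show "((\<lambda>y. g (L - y)) has_real_derivative - g' (L - y)) (at y within {0..L})" if "y \<in> {0..L}" for y
    proof -
      have "((\<lambda>y. L - y) has_real_derivative - 1) (at y within {0..L})"
        by (auto intro!: derivative_eq_intros)
      moreover have "(\<lambda>y. L - y) ` {0..L} \<subseteq> {0..L}" by auto
      ultimately show ?thesis
        using DERIV_image_chain[of g "g' (L - y)" "\<lambda>y. L - y" y "{0..L}" "-1"] der[of "L - y"] that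
        by (auto simp: o_def intro: has_field_derivative_subset)
    qed
  qed (use assms in auto)
  then show ?thesis by simp
qed

section \<open>The change of unknown at the sonic value\<close>

text \<open>The unknown \<open>f\<close> is \<open>\<sigma> * (1 - 1/\<rho>)\<close>, nonnegative on
  the subsonic side (\<open>\<sigma> = 1\<close>) and on the supersonic side
  (\<open>\<sigma> = -1\<close>) alike. It makes the right-hand side linear:
  \<open>E - 1/(\<tau> * \<rho>)\<close> becomes \<open>\<sigma> * (f/\<tau> - q)\<close>.\<close>

definition recip :: "real \<Rightarrow> real \<Rightarrow> real" where
  "recip \<sigma> f = 1 / (1 - \<sigma> * f)"

text \<open>With \<open>\<rho> = recip \<sigma> f\<close> this is \<open>ln \<rho> + 1/(2\<rho>\<^sup>2) - 1/2\<close>, the primitive of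
  \<open>(1 - 1/\<rho>\<^sup>2)/\<rho>\<close> that vanishes at the sonic value \<open>\<rho> = 1\<close>.\<close>
definition potential :: "real \<Rightarrow> real \<Rightarrow> real" where
  "potential \<sigma> f = (1 - \<sigma> * f)\<^sup>2 / 2 - 1 / 2 - ln (1 - \<sigma> * f)"

definition potential' :: "real \<Rightarrow> real \<Rightarrow> real" where
  "potential' \<sigma> f = \<sigma> * (recip \<sigma> f - (1 - \<sigma> * f))"

text \<open>The argument is clamped to the range of \<open>potential \<sigma>\<close> on \<open>[0, 1/2]\<close>, which makes the inverse
  total and monotone.\<close>
definition potential_inv :: "real \<Rightarrow> real \<Rightarrow> real" where
  "potential_inv \<sigma> h = inv_into {0..1/2} (potential \<sigma>) (max 0 (min h (potential \<sigma> (1/2))))"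

locale direction =
  fixes \<sigma> :: real
  assumes sigma: "\<sigma> = 1 \<or> \<sigma> = -1"
begin

lemma denom_ge: "0 \<le> f \<Longrightarrow> f \<le> 1/2 \<Longrightarrow> 1/2 \<le> 1 - \<sigma> * f"
  using sigma by auto

lemma has_derivative_potential:
  assumes "0 \<le> f" "f \<le> 1/2"
  shows "(potential \<sigma> has_real_derivative potential' \<sigma> f) (at f)"
  unfolding potential_def [abs_def] potential'_def recip_def using denom_ge[OF assms]
  by (auto intro!: derivative_eq_intros simp: field_simps)

lemma potential'_eq:
  assumes "0 \<le> f" "f \<le> 1/2"
  shows "potential' \<sigma> f = f * ((2 - \<sigma> * f) / (1 - \<sigma> * f))"
  using denom_ge[OF assms] sigma by (auto simp: potential'_def recip_def field_simps)

text \<open>The quotient in \<open>potential'_eq\<close> stays between 1 and 3 on this range. The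
  linear vanishing at \<open>f = 0\<close> is the degeneracy at the sonic value.\<close>

lemma potential'_bounds:
  assumes "0 \<le> f" "f \<le> 1/2"
  shows "f \<le> potential' \<sigma> f" "potential' \<sigma> f \<le> 3 * f"
proof -
  have "1 \<le> (2 - \<sigma> * f) / (1 - \<sigma> * f)" "(2 - \<sigma> * f) / (1 - \<sigma> * f) \<le> 3"
    using denom_ge[OF assms] assms sigma by (auto simp: field_simps)
  from this[THEN mult_left_mono, of f] show "f \<le> potential' \<sigma> f" "potential' \<sigma> f \<le> 3 * f"
    using assms by (simp_all add: potential'_eq mult.commute)
qed

lemma potential_0 [simp]: "potential \<sigma> 0 = 0"
  by (simp add: potential_def)

text \<open>Integrates \<open>potential' \<ge> f\<close>. This quadratic growth yields strict
  monotonicity and, for the inverse, a square root modulus of continuity.\<close>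

lemma potential_diff_ge:
  assumes "0 \<le> f" "f \<le> g" "g \<le> 1/2"
  shows "(g\<^sup>2 - f\<^sup>2) / 2 \<le> potential \<sigma> g - potential \<sigma> f"
proof -
  have "potential \<sigma> f - f\<^sup>2 / 2 \<le> potential \<sigma> g - g\<^sup>2 / 2"
  proof (rule DERIV_nonneg_imp_nondecreasing[OF assms(2)])
    fix x assume x: "f \<le> x" "x \<le> g"
    then have "((\<lambda>x. potential \<sigma> x - x\<^sup>2 / 2) has_real_derivative potential' \<sigma> x - x) (at x)"
      using assms by (auto intro!: derivative_eq_intros has_derivative_potential)
    moreover have "0 \<le> potential' \<sigma> x - x"
      using potential'_bounds(1)[of x] x assms by simp
    ultimately show "\<exists>y. ((\<lambda>x. potential \<sigma> x - x\<^sup>2 / 2) has_real_derivative y) (at x) \<and> 0 \<le> y" by blast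
  qed
  then show ?thesis by (simp add: field_simps)
qed

lemma potential_mono:
  assumes "0 \<le> f" "f \<le> g" "g \<le> 1/2"
  shows "potential \<sigma> f \<le> potential \<sigma> g"
  using potential_diff_ge[OF assms] power_mono[OF assms(2,1), of 2] by simp

lemma potential_strict_mono:
  assumes "0 \<le> f" "f < g" "g \<le> 1/2"
  shows "potential \<sigma> f < potential \<sigma> g"
  using potential_diff_ge[of f g] power_strict_mono[of f g 2] assms by simp

lemma inj_potential: "inj_on (potential \<sigma>) {0..1/2}"
  by (rule linorder_inj_onI') (use potential_strict_mono in fastforce)

lemma continuous_potential: "continuous_on {0..1/2} (potential \<sigma>)"
  by (rule DERIV_continuous_on, rule has_field_derivative_at_within, rule has_derivative_potential) auto

lemma potential_half_nonneg: "0 \<le> potential \<sigma> (1/2)"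
  using potential_mono[of 0 "1/2"] by simp

section \<open>Regularity of the inverse potential\<close>

lemma potential_inv:
  shows "potential_inv \<sigma> h \<in> {0..1/2}"
    and "potential \<sigma> (potential_inv \<sigma> h) = max 0 (min h (potential \<sigma> (1/2)))"
proof -
  have "\<exists>x. 0 \<le> x \<and> x \<le> 1/2 \<and> potential \<sigma> x = max 0 (min h (potential \<sigma> (1/2)))"
    using potential_half_nonneg by (intro IVT' continuous_potential) auto
  then have "max 0 (min h (potential \<sigma> (1/2))) \<in> potential \<sigma> ` {0..1/2}"
    by (metis atLeastAtMost_iff imageI)
  from inv_into_into[OF this] f_inv_into_f[OF this]
  show "potential_inv \<sigma> h \<in> {0..1/2}"
    and "potential \<sigma> (potential_inv \<sigma> h) = max 0 (min h (potential \<sigma> (1/2)))"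
    by (simp_all add: potential_inv_def)
qed

lemma potential_inv_nonneg: "0 \<le> potential_inv \<sigma> h"
  and potential_inv_le: "potential_inv \<sigma> h \<le> 1/2"
  using potential_inv(1)[of h] by auto

lemma potential_inv_potential:
  assumes "0 \<le> f" "f \<le> 1/2"
  shows "potential_inv \<sigma> (potential \<sigma> f) = f"
proof (rule inj_onD[OF inj_potential])
  show "potential \<sigma> (potential_inv \<sigma> (potential \<sigma> f)) = potential \<sigma> f"
    using potential_mono[of 0 f] potential_mono[of f "1/2"] assms by (simp add: potential_inv(2))
qed (use potential_inv assms in auto)

lemma mono_potential_inv: "mono (potential_inv \<sigma>)"
proof (rule monoI, rule ccontr)
  fix u v :: real assume "u \<le> v" "\<not> potential_inv \<sigma> u \<le> potential_inv \<sigma> v"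
  then have "potential \<sigma> (potential_inv \<sigma> v) < potential \<sigma> (potential_inv \<sigma> u)"
    using potential_inv(1) by (intro potential_strict_mono) auto
  moreover have "max 0 (min u (potential \<sigma> (1/2))) \<le> max 0 (min v (potential \<sigma> (1/2)))"
    using \<open>u \<le> v\<close> by (intro max.mono min.mono) auto
  ultimately show False unfolding potential_inv(2) by linarith
qed

lemma potential_inv_nonpos [simp]: "u \<le> 0 \<Longrightarrow> potential_inv \<sigma> u = 0"
  using potential_inv_potential[of 0] potential_half_nonneg
  by (simp add: potential_inv_def max_def min_def)

text \<open>Quadratic growth of the potential read backwards; clamping the argument does not
  increase distances, so the bound holds on the whole line.\<close>

lemma potential_inv_sqdiff:
  assumes "u \<le> v"
  shows "(potential_inv \<sigma> v)\<^sup>2 - (potential_inv \<sigma> u)\<^sup>2 \<le> 2 * (v - u)"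
proof -
  have "((potential_inv \<sigma> v)\<^sup>2 - (potential_inv \<sigma> u)\<^sup>2) / 2
      \<le> potential \<sigma> (potential_inv \<sigma> v) - potential \<sigma> (potential_inv \<sigma> u)"
    using potential_inv_nonneg potential_inv_le monoD[OF mono_potential_inv assms]
    by (intro potential_diff_ge) auto
  also have "\<dots> \<le> v - u"
    using assms by (simp add: potential_inv(2))
  finally show ?thesis by simp
qed

text \<open>For \<open>0 \<le> a \<le> c\<close> the square of \<open>c - a\<close> is at most the
  difference of the squares, so the bound on squares becomes Hoelder continuity of exponent
  1/2.\<close>

lemma potential_inv_dist: "\<bar>potential_inv \<sigma> u - potential_inv \<sigma> v\<bar> \<le> sqrt (2 * \<bar>u - v\<bar>)"
proof -
  have *: "potential_inv \<sigma> v - potential_inv \<sigma> u \<le> sqrt (2 * (v - u))" if "u \<le> v" for u v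
  proof (rule real_le_rsqrt)
    have "(potential_inv \<sigma> v - potential_inv \<sigma> u)\<^sup>2 \<le>
          (potential_inv \<sigma> v - potential_inv \<sigma> u) * (potential_inv \<sigma> v + potential_inv \<sigma> u)"
      unfolding power2_eq_square
      using monoD[OF mono_potential_inv that] potential_inv_nonneg[of u] by (intro mult_left_mono) auto
    also have "\<dots> \<le> 2 * (v - u)"
      using potential_inv_sqdiff[OF that] by (simp add: algebra_simps power2_eq_square)
    finally show "(potential_inv \<sigma> v - potential_inv \<sigma> u)\<^sup>2 \<le> 2 * (v - u)" .
  qed
  show ?thesis
    using *[of u v] *[of v u] monoD[OF mono_potential_inv, of u v] monoD[OF mono_potential_inv, of v u]
    by (cases "u \<le> v") auto
qed

lemma uniformly_continuous_potential_inv: "uniformly_continuous_on UNIV (potential_inv \<sigma>)"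
  unfolding uniformly_continuous_on_def
proof (intro allI impI)
  fix e :: real assume e: "e > 0"
  have "dist (potential_inv \<sigma> u) (potential_inv \<sigma> v) < e" if "dist u v < e\<^sup>2 / 2" for u v
  proof -
    have "sqrt (2 * \<bar>u - v\<bar>) < e"
      using that e by (intro real_less_lsqrt) (auto simp: dist_real_def)
    then show ?thesis using potential_inv_dist[of u v] by (simp add: dist_real_def)
  qed
  then show "\<exists>d>0. \<forall>x\<in>UNIV. \<forall>x'\<in>UNIV. dist x' x < d \<longrightarrow> dist (potential_inv \<sigma> x') (potential_inv \<sigma> x) < e"
    using e by (intro exI[of _ "e\<^sup>2 / 2"]) auto
qed

lemma potential_inv_pos: "potential_inv \<sigma> h > 0" if "h > 0"
proof (rule ccontr)
  assume "\<not> ?thesis"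
  then have "potential_inv \<sigma> h = 0" using potential_inv_nonneg[of h] by simp
  with potential_inv(2)[of h] that potential_strict_mono[of 0 "1/2"] show False by simp
qed

text \<open>Away from 0 the sum of two values is at least \<open>2 * m\<close>, and dividing the
  difference of squares by it gives a Lipschitz bound, as \<open>monotone_ode_exists\<close>
  requires.\<close>

lemma potential_inv_lipschitz:
  assumes "\<epsilon> > 0"
  shows "\<exists>\<Lambda>>0. \<forall>u\<ge>\<epsilon>. \<forall>v\<ge>\<epsilon>. \<bar>potential_inv \<sigma> u - potential_inv \<sigma> v\<bar> \<le> \<Lambda> * \<bar>u - v\<bar>"
proof -
  define m where "m = potential_inv \<sigma> \<epsilon>"
  have m: "m > 0" using potential_inv_pos[OF assms] by (simp add: m_def)
  have *: "\<bar>potential_inv \<sigma> u - potential_inv \<sigma> v\<bar> \<le> 1 / m * \<bar>u - v\<bar>" if "\<epsilon> \<le> v" "v \<le> u" for u v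
  proof -
    have "2 * m \<le> potential_inv \<sigma> u + potential_inv \<sigma> v"
      using monoD[OF mono_potential_inv, of \<epsilon> u] monoD[OF mono_potential_inv, of \<epsilon> v] that
      by (simp add: m_def)
    then have "(potential_inv \<sigma> u - potential_inv \<sigma> v) * (2 * m)
        \<le> (potential_inv \<sigma> u - potential_inv \<sigma> v) * (potential_inv \<sigma> u + potential_inv \<sigma> v)"
      using monoD[OF mono_potential_inv \<open>v \<le> u\<close>] by (intro mult_left_mono) auto
    also have "\<dots> \<le> 2 * (u - v)"
      using potential_inv_sqdiff[OF \<open>v \<le> u\<close>] by (simp add: algebra_simps power2_eq_square)
    finally show ?thesis
      using monoD[OF mono_potential_inv \<open>v \<le> u\<close>] m that by (simp add: field_simps)
  qed
  have "\<bar>potential_inv \<sigma> u - potential_inv \<sigma> v\<bar> \<le> 1 / m * \<bar>u - v\<bar>" if "\<epsilon> \<le> v" "\<epsilon> \<le> u" for u v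
    using *[of v u] *[of u v] that by (cases "v \<le> u") (auto simp: abs_minus_commute)
  then show ?thesis using m by (intro exI[of _ "1 / m"]) auto
qed

text \<open>Both denominators are at least 1/2, whence the factor 4, which reappears in the
  contraction constant \<open>4 * \<tau>\<close>.\<close>

lemma recip_dist:
  assumes "0 \<le> f" "f \<le> 1/2" "0 \<le> g" "g \<le> 1/2"
  shows "\<bar>recip \<sigma> f - recip \<sigma> g\<bar> \<le> 4 * \<bar>f - g\<bar>"
proof -
  let ?u = "1 - \<sigma> * f" and ?v = "1 - \<sigma> * g"
  have uv: "1/2 \<le> ?u" "1/2 \<le> ?v" using denom_ge assms by auto
  have "1/2 * (1/2) \<le> ?u * ?v" using uv by (intro mult_mono) auto
  then have "\<bar>f - g\<bar> \<le> 4 * \<bar>f - g\<bar> * (?u * ?v)"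
    using mult_left_mono[of "1/4" "?u * ?v" "4 * \<bar>f - g\<bar>"] by simp
  moreover have "recip \<sigma> f - recip \<sigma> g = \<sigma> * (f - g) / (?u * ?v)"
    using uv by (simp add: recip_def field_simps)
  moreover have "\<bar>\<sigma>\<bar> = 1" using sigma by auto
  ultimately show ?thesis
    using uv by (simp add: abs_mult pos_divide_le_eq)
qed

lemma continuous_recip: "continuous_on {0..1/2} (recip \<sigma>)"
  unfolding recip_def [abs_def]
proof (intro continuous_intros ballI)
  fix f :: real assume "f \<in> {0..1/2}"
  then show "1 - \<sigma> * f \<noteq> 0" using denom_ge[of f] by auto
qed

end

section \<open>Existence of a profile\<close>

text \<open>\<open>4 * b * \<tau> \<le> 1\<close> keeps the barrier slope
  \<open>2 * b * \<tau>\<close> at most 1/2, inside the range where the potential is inverted. The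
  last bound on \<tau> keeps the density at most \<open>(b + 1) / 2\<close>, so that
  \<open>b - \<rho>\<close> stays at least \<open>(b - 1) / 2\<close>. \<open>L\<close> is the
  length of one piece.\<close>

locale profile = direction +
  fixes b \<tau> L :: real
  assumes b: "b > 1" and tau: "0 < \<tau>" "4 * b * \<tau> \<le> 1" "2 * b * \<tau> \<le> (b - 1) / (b + 1)"
    and L: "0 < L" "L \<le> 1"
begin

lemma tau_less: "4 * \<tau> < 1"
proof -
  have "4 * 1 * \<tau> < 4 * b * \<tau>" using b tau by (intro mult_strict_right_mono) auto
  then show ?thesis using tau(2) by linarith
qed

text \<open>Only the value at \<open>L\<close> is prescribed, because the equation is dissipative in
  the backward direction. The value \<open>h 0 = 0\<close> is not imposed; for admissible
  \<open>q\<close> it follows from barriers.\<close>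

definition solves_for :: "(real \<Rightarrow> real) \<Rightarrow> (real \<Rightarrow> real) \<Rightarrow> bool" where
  "solves_for q h \<longleftrightarrow> h L = 0 \<and>
     (\<forall>x\<in>{0..L}. (h has_real_derivative potential_inv \<sigma> (h x) / \<tau> - q x) (at x within {0..L}))"

lemma solves_forD:
  assumes "solves_for q h"
  shows "h L = 0"
    and "x \<in> {0..L} \<Longrightarrow> (h has_real_derivative potential_inv \<sigma> (h x) / \<tau> - q x) (at x within {0..L})"
  using assms by (auto simp: solves_for_def)

lemma solves_for_continuous: "solves_for q h \<Longrightarrow> continuous_on {0..L} h"
  by (rule DERIV_continuous_on, rule solves_forD)

lemma continuous_potential_inv_solution: "solves_for q h \<Longrightarrow> continuous_on {0..L} (\<lambda>x. potential_inv \<sigma> (h x))"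
  using uniformly_continuous_imp_continuous[OF uniformly_continuous_potential_inv] solves_for_continuous
  by (rule continuous_on_compose2) auto

text \<open>After reflection the right-hand side is a given function minus a nondecreasing function
  of the unknown, so \<open>monotone_ode_exists\<close> applies.\<close>

lemma solves_for_exists:
  assumes q: "continuous_on {0..L} q"
  shows "\<exists>h. solves_for q h"
proof -
  have flip: "(\<lambda>y. L - y) ` {0..L} = {0..L}"
    by (auto simp: image_iff intro!: bexI[of _ "L - y" for y])
  have "\<exists>k. k 0 = 0 \<and> (\<forall>y\<in>{0..L}. (k has_real_derivative q (L - y) - potential_inv \<sigma> (k y) / \<tau>) (at y within {0..L}))"
  proof (rule monotone_ode_exists)
    show "mono (\<lambda>u. potential_inv \<sigma> u / \<tau>)"
      using tau by (intro monoI divide_right_mono monoD[OF mono_potential_inv]) auto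
    show "uniformly_continuous_on UNIV (\<lambda>u. potential_inv \<sigma> u / \<tau>)"
      using uniformly_continuous_on_cmul_right[OF uniformly_continuous_potential_inv, of "1/\<tau>"] by simp
    show "\<exists>\<Lambda>>0. \<forall>u\<ge>\<epsilon>. \<forall>v\<ge>\<epsilon>. \<bar>potential_inv \<sigma> u / \<tau> - potential_inv \<sigma> v / \<tau>\<bar> \<le> \<Lambda> * \<bar>u - v\<bar>"
      if eps: "\<epsilon> > 0" for \<epsilon>
    proof -
      obtain \<Lambda> where \<Lambda>: "\<Lambda> > 0"
        "\<And>u v. u \<ge> \<epsilon> \<Longrightarrow> v \<ge> \<epsilon> \<Longrightarrow> \<bar>potential_inv \<sigma> u - potential_inv \<sigma> v\<bar> \<le> \<Lambda> * \<bar>u - v\<bar>"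
        using potential_inv_lipschitz[OF eps] by blast
      have "\<bar>potential_inv \<sigma> u / \<tau> - potential_inv \<sigma> v / \<tau>\<bar> \<le> \<Lambda> / \<tau> * \<bar>u - v\<bar>" if "u \<ge> \<epsilon>" "v \<ge> \<epsilon>" for u v
        using divide_right_mono[OF \<Lambda>(2)[OF that], of \<tau>] tau by (simp add: abs_divide flip: diff_divide_distrib)
      then show ?thesis using \<Lambda>(1) tau by (intro exI[of _ "\<Lambda> / \<tau>"]) auto
    qed
    show "continuous_on {0..L} (\<lambda>y. q (L - y))"
      by (rule continuous_on_compose2[OF q]) (auto intro!: continuous_intros)
  qed (use L in auto)
  then obtain k where k0: "k 0 = 0"
    and k: "\<And>y. y \<in> {0..L} \<Longrightarrow> (k has_real_derivative q (L - y) - potential_inv \<sigma> (k y) / \<tau>) (at y within {0..L})"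
    by blast
  have "((\<lambda>x. k (L - x)) has_real_derivative potential_inv \<sigma> (k (L - x)) / \<tau> - q x) (at x within {0..L})"
    if "x \<in> {0..L}" for x
  proof -
    have "((\<lambda>y. L - y) has_real_derivative - 1) (at x within {0..L})"
      by (auto intro!: derivative_eq_intros)
    then show ?thesis
      using DERIV_image_chain[of k _ "\<lambda>y. L - y" x "{0..L}" "-1"] k[of "L - x"] that
      by (fastforce simp: o_def flip)
  qed
  then have "solves_for q (\<lambda>x. k (L - x))"
    by (simp add: solves_for_def k0)
  then show ?thesis by blast
qed

text \<open>Where \<open>h > k\<close>, the monotone term and \<open>q \<le> r\<close> both push the
  difference upwards, so it cannot return to 0 at \<open>L\<close>.\<close>

lemma solves_for_mono:
  assumes "solves_for q h" "solves_for r k" "\<And>x. x \<in> {0..L} \<Longrightarrow> q x \<le> r x" "x \<in> {0..L}"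
  shows "h x \<le> k x"
proof -
  have "h x - k x \<le> 0"
  proof (rule backward_nonpos[OF _ _ _ assms(4)])
    show "((\<lambda>x. h x - k x) has_real_derivative
       (potential_inv \<sigma> (h x) / \<tau> - q x) - (potential_inv \<sigma> (k x) / \<tau> - r x)) (at x within {0..L})"
      if "x \<in> {0..L}" for x
      by (intro derivative_intros solves_forD(2)[OF _ that] assms)
    show "0 \<le> (potential_inv \<sigma> (h x) / \<tau> - q x) - (potential_inv \<sigma> (k x) / \<tau> - r x)"
      if "x \<in> {0..L}" "h x - k x > 0" for x
      using assms(3)[OF that(1)] that divide_right_mono[OF monoD[OF mono_potential_inv, of "k x" "h x"], of \<tau>] tau
      by simp
  qed (simp add: solves_forD(1)[OF assms(1)] solves_forD(1)[OF assms(2)])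
  then show ?thesis by simp
qed

section \<open>Barriers and size estimates for the backward problem\<close>

definition slope_bound :: real where "slope_bound = 2 * b * \<tau>"

lemma slope_bound: "0 < slope_bound" "slope_bound \<le> 1/2"
  using b tau by (auto simp: slope_bound_def)

text \<open>Zero is a lower barrier and the linear profile of slope \<open>2 * b * \<tau>\<close> an
  upper one: above it \<open>f / \<tau>\<close> is at least \<open>2 * b * x\<close>, which exceeds
  \<open>q x \<le> b * x\<close> by a margin \<open>b * x\<close> that pays for the growth of the
  barrier. At \<open>x = 0\<close> the two bounds meet and force \<open>h 0 = 0\<close>.\<close>

lemma solves_for_bounds:
  assumes h: "solves_for q h" and q: "\<And>x. x \<in> {0..L} \<Longrightarrow> 0 \<le> q x \<and> q x \<le> b * x" and x: "x \<in> {0..L}"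
  shows "0 \<le> h x" and "h x \<le> potential \<sigma> (slope_bound * x)"
proof -
  have "- h x \<le> 0"
    by (rule backward_nonpos[OF DERIV_minus[OF solves_forD(2)[OF h]] _ _ x])
      (use solves_forD(1)[OF h] q in auto)
  then show "0 \<le> h x" by simp
  define k where "k = slope_bound"
  have k: "0 < k" "k \<le> 1/2" using slope_bound by (auto simp: k_def)
  have kx: "0 \<le> k * x" "k * x \<le> 1/2" if "x \<in> {0..L}" for x
  proof -
    have "k * x \<le> 1/2 * 1" using that k L by (intro mult_mono) auto
    then show "0 \<le> k * x" "k * x \<le> 1/2" using that k by auto
  qed
  have "h x - potential \<sigma> (k * x) \<le> 0"
  proof (rule backward_nonpos[OF _ _ _ x])
    show "((\<lambda>x. h x - potential \<sigma> (k * x)) has_real_derivative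
        (potential_inv \<sigma> (h x) / \<tau> - q x) - potential' \<sigma> (k * x) * k) (at x within {0..L})"
      if x: "x \<in> {0..L}" for x
    proof -
      have "((\<lambda>x. potential \<sigma> (k * x)) has_real_derivative potential' \<sigma> (k * x) * k) (at x within {0..L})"
        by (rule DERIV_chain2[OF has_derivative_potential]) (use kx[OF x] in \<open>auto intro!: derivative_eq_intros\<close>)
      then show ?thesis by (intro derivative_intros solves_forD(2)[OF h x])
    qed
    show "h L - potential \<sigma> (k * L) \<le> 0"
      using potential_mono[of 0 "k * L"] kx[of L] L by (simp add: solves_forD(1)[OF h])
    show "0 \<le> (potential_inv \<sigma> (h x) / \<tau> - q x) - potential' \<sigma> (k * x) * k"
      if x: "x \<in> {0..L}" and pos: "h x - potential \<sigma> (k * x) > 0" for x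
    proof -
      have "k * x \<le> potential_inv \<sigma> (h x)"
        using monoD[OF mono_potential_inv, of "potential \<sigma> (k * x)" "h x"] pos
          potential_inv_potential[of "k * x"] kx[OF x] by simp
      then have "k * x / \<tau> \<le> potential_inv \<sigma> (h x) / \<tau>"
        using tau by (intro divide_right_mono) auto
      moreover have "k * x / \<tau> = 2 * b * x" using tau by (simp add: k_def slope_bound_def)
      moreover have "potential' \<sigma> (k * x) * k \<le> 3 * (k * x) * k"
        using potential'_bounds(2) kx[OF x] k by (intro mult_right_mono) auto
      \<comment> \<open>The left side is \<open>12 * b\<^sup>2 * \<tau>\<^sup>2 * x\<close>;
        \<open>4 * b * \<tau> \<le> 1\<close> and \<open>\<tau> \<le> 1/4\<close> bound it even by
        three quarters of \<open>b * x\<close>.\<close>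
      moreover have "3 * (k * x) * k \<le> b * x"
      proof -
        have "(4 * b * \<tau>) * \<tau> \<le> 1 * (1/4)"
        proof (rule mult_mono)
          show "\<tau> \<le> 1/4" using tau_less by simp
        qed (use tau in auto)
        then have "3 * (4 * b * \<tau> * \<tau>) * (b * x) \<le> 1 * (b * x)"
          using b x by (intro mult_right_mono) auto
        then show ?thesis by (simp add: k_def slope_bound_def algebra_simps)
      qed
      moreover have "q x \<le> b * x" using q[OF x] by simp
      ultimately show ?thesis by linarith
    qed
  qed
  then show "h x \<le> potential \<sigma> (slope_bound * x)" by (simp add: k_def)
qed

lemma potential_inv_solution_le:
  assumes h: "solves_for q h" and q: "\<And>x. x \<in> {0..L} \<Longrightarrow> 0 \<le> q x \<and> q x \<le> b * x" and x: "x \<in> {0..L}"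
  shows "potential_inv \<sigma> (h x) \<le> slope_bound * x"
proof -
  have "slope_bound * x \<le> 1/2 * 1" using x slope_bound L by (intro mult_mono) auto
  moreover have "0 \<le> slope_bound * x" using x slope_bound by auto
  ultimately show ?thesis
    using monoD[OF mono_potential_inv solves_for_bounds(2)[OF h q x]] by (simp add: potential_inv_potential)
qed

lemma recip_bounds:
  assumes "0 \<le> f" "f \<le> slope_bound"
  shows "0 \<le> recip \<sigma> f" "recip \<sigma> f \<le> (b + 1) / 2"
proof -
  have f: "f \<le> 1/2" "1/2 \<le> 1 - \<sigma> * f" using denom_ge[of f] slope_bound assms by auto
  then show "0 \<le> recip \<sigma> f" by (simp add: recip_def)
  have "f \<le> (b - 1) / (b + 1)" using assms tau by (simp add: slope_bound_def)
  then have "f * (b + 1) \<le> b - 1" using b by (simp add: field_simps)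
  moreover have "0 \<le> f * (b + 1)" using assms b by simp
  ultimately have "2 \<le> (b + 1) * (1 - \<sigma> * f)" using sigma b by (auto simp: algebra_simps)
  then show "recip \<sigma> f \<le> (b + 1) / 2"
    using f by (simp add: recip_def field_simps)
qed

text \<open>Integrate the difference of the two equations over the whole interval: the boundary term
  vanishes at \<open>L\<close> and, by comparison, has a favourable sign at 0. No Lipschitz bound on
  the inverse potential enters.\<close>

lemma integral_solution_diff_le:
  assumes q: "continuous_on {0..L} q" "continuous_on {0..L} r"
    and hk: "solves_for q h" "solves_for r k" and le: "\<And>x. x \<in> {0..L} \<Longrightarrow> q x \<le> r x"
  shows "integral {0..L} (\<lambda>x. potential_inv \<sigma> (k x) - potential_inv \<sigma> (h x)) \<le> \<tau> * integral {0..L} (\<lambda>x. r x - q x)"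
proof -
  let ?F = "\<lambda>x. potential_inv \<sigma> (k x) - potential_inv \<sigma> (h x)"
  have int: "?F integrable_on {0..L}" "(\<lambda>x. r x - q x) integrable_on {0..L}"
    using continuous_potential_inv_solution[OF hk(1)] continuous_potential_inv_solution[OF hk(2)] q
    by (intro integrable_continuous_interval continuous_intros; simp)+
  have "((\<lambda>x. (potential_inv \<sigma> (k x) / \<tau> - r x) - (potential_inv \<sigma> (h x) / \<tau> - q x)) has_integral
       (k L - h L) - (k 0 - h 0)) {0..L}"
    using L solves_forD(2)[OF hk(1)] solves_forD(2)[OF hk(2)]
    by (intro fundamental_theorem_of_calculus)
      (auto intro!: derivative_intros simp flip: has_real_derivative_iff_has_vector_derivative)
  then have "integral {0..L} (\<lambda>x. ?F x / \<tau> - (r x - q x)) = h 0 - k 0"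
    by (simp add: integral_unique solves_forD(1)[OF hk(1)] solves_forD(1)[OF hk(2)] diff_divide_distrib algebra_simps)
  moreover have "integral {0..L} (\<lambda>x. ?F x / \<tau> - (r x - q x)) = integral {0..L} ?F / \<tau> - integral {0..L} (\<lambda>x. r x - q x)"
    using int by (simp add: integral_diff integrable_on_divide)
  moreover have "h 0 \<le> k 0"
    using solves_for_mono[OF hk le, of 0] L by simp
  ultimately have "integral {0..L} ?F / \<tau> \<le> integral {0..L} (\<lambda>x. r x - q x)"
    by linarith
  then show ?thesis using tau by (simp add: pos_divide_le_eq mult.commute)
qed

text \<open>The solution for \<open>max q r\<close> dominates both solutions, which reduces the estimate to ordered data.\<close>
lemma integral_solution_dist_le:
  assumes q: "continuous_on {0..L} q" "continuous_on {0..L} r"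
    and hk: "solves_for q h" "solves_for r k"
  shows "integral {0..L} (\<lambda>x. \<bar>potential_inv \<sigma> (h x) - potential_inv \<sigma> (k x)\<bar>) \<le> \<tau> * integral {0..L} (\<lambda>x. \<bar>q x - r x\<bar>)"
proof -
  define s where "s x = max (q x) (r x)" for x
  have s: "continuous_on {0..L} s" unfolding s_def using q by (intro continuous_intros)
  obtain m where m: "solves_for s m" using solves_for_exists[OF s] by blast
  let ?F = "\<lambda>h x. potential_inv \<sigma> (h x)"
  note cont = continuous_potential_inv_solution[OF hk(1)] continuous_potential_inv_solution[OF hk(2)]
    continuous_potential_inv_solution[OF m]
  have le: "?F h x \<le> ?F m x" "?F k x \<le> ?F m x" if "x \<in> {0..L}" for x
    using solves_for_mono[OF hk(1) m _ that] solves_for_mono[OF hk(2) m _ that]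
    by (auto simp: s_def intro!: monoD[OF mono_potential_inv])
  have "integral {0..L} (\<lambda>x. \<bar>?F h x - ?F k x\<bar>) \<le> integral {0..L} (\<lambda>x. (?F m x - ?F h x) + (?F m x - ?F k x))"
    using cont le by (intro integral_le integrable_continuous_interval continuous_intros) (auto simp: abs_le_iff)
  also have "\<dots> = integral {0..L} (\<lambda>x. ?F m x - ?F h x) + integral {0..L} (\<lambda>x. ?F m x - ?F k x)"
    using cont by (intro integral_add integrable_continuous_interval continuous_intros)
  also have "\<dots> \<le> \<tau> * integral {0..L} (\<lambda>x. s x - q x) + \<tau> * integral {0..L} (\<lambda>x. s x - r x)"
    by (intro add_mono integral_solution_diff_le s q hk m) (auto simp: s_def)
  also have "\<dots> = \<tau> * integral {0..L} (\<lambda>x. (s x - q x) + (s x - r x))"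
    using s q by (subst integral_add) (auto intro!: integrable_continuous_interval continuous_intros simp: distrib_left)
  \<comment> \<open>Twice the maximum minus the sum is the absolute difference, so passing through
    \<open>max q r\<close> loses no factor.\<close>
  also have "(\<lambda>x. (s x - q x) + (s x - r x)) = (\<lambda>x. \<bar>q x - r x\<bar>)"
    by (auto simp: s_def max_def)
  finally show ?thesis .
qed


text \<open>A contraction in the supremum norm on the cone
  \<open>(b - 1) / 2 * x \<le> q x \<le> b * x\<close>. The next iterate is an integral, so
  stability of \<open>f\<close> in the integral norm suffices: the constant 4 of
  \<open>recip\<close>, the factor \<tau> and \<open>L \<le> 1\<close> combine to
  \<open>4 * \<tau> < 1\<close>.\<close>

lemma profile_exists:
  obtains q h where
    "solves_for q h" "q 0 = 0"
    "\<And>x. x \<in> {0..L} \<Longrightarrow> (b - 1) / 2 * x \<le> q x \<and> q x \<le> b * x"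
    "\<And>x. x \<in> {0..L} \<Longrightarrow> (q has_real_derivative b - recip \<sigma> (potential_inv \<sigma> (h x))) (at x within {0..L})"
proof -
  define S where "S = {q. continuous_on {0..L} q \<and> (\<forall>x\<in>{0..L}. q x \<in> {(b - 1) / 2 * x..b * x})}"
  define hsol where "hsol q = (SOME h. solves_for q h)" for q
  have hsol: "solves_for q (hsol q)" if "q \<in> S" for q
    unfolding hsol_def using someI_ex[OF solves_for_exists[of q]] that by (simp add: S_def)
  define f where "f q x = potential_inv \<sigma> (hsol q x)" for q x
  define T where "T q x = integral {0..x} (\<lambda>s. b - recip \<sigma> (f q s))" for q x
  have q_bounds: "0 \<le> q x \<and> q x \<le> b * x" if "q \<in> S" "x \<in> {0..L}" for q x
  proof -
    have "0 \<le> (b - 1) / 2 * x" using b that by simp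
    moreover have "(b - 1) / 2 * x \<le> q x \<and> q x \<le> b * x" using that by (auto simp: S_def)
    ultimately show ?thesis by linarith
  qed
  have f_bounds: "0 \<le> f q x" "f q x \<le> slope_bound" "f q x \<le> 1/2" if "q \<in> S" "x \<in> {0..L}" for q x
  proof -
    show "0 \<le> f q x" "f q x \<le> 1/2"
      unfolding f_def by (rule potential_inv_nonneg potential_inv_le)+
    have "f q x \<le> slope_bound * x"
      unfolding f_def by (rule potential_inv_solution_le[OF hsol q_bounds]) (use that in auto)
    also have "\<dots> \<le> slope_bound * 1" using that L slope_bound by (intro mult_left_mono) auto
    finally show "f q x \<le> slope_bound" by simp
  qed
  have cont_f: "continuous_on {0..L} (f q)" if "q \<in> S" for q
    unfolding f_def using continuous_potential_inv_solution[OF hsol[OF that]] .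
  have cont_r: "continuous_on {0..L} (\<lambda>x. b - recip \<sigma> (f q x))" if "q \<in> S" for q
    by (intro continuous_intros continuous_on_compose2[OF continuous_recip cont_f[OF that]])
      (use f_bounds[OF that] in auto)
  have der_T: "(T q has_real_derivative b - recip \<sigma> (f q x)) (at x within {0..L})"
    if "q \<in> S" "x \<in> {0..L}" for q x
    unfolding T_def by (rule integral_has_real_derivative[OF cont_r[OF that(1)] that(2)])
  have int_r: "(\<lambda>s. b - recip \<sigma> (f q s)) integrable_on {0..x}" if "q \<in> S" "x \<in> {0..L}" for q x
    by (rule integrable_continuous_interval[OF continuous_on_subset[OF cont_r[OF that(1)]]]) (use that in auto)
  have TS: "T q \<in> S" if q: "q \<in> S" for q
    unfolding S_def
  proof (intro CollectI conjI ballI)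
    show "continuous_on {0..L} (T q)"
      using der_T[OF q] by (rule DERIV_continuous_on)
    fix x assume x: "x \<in> {0..L}"
    have r: "0 \<le> recip \<sigma> (f q s)" "recip \<sigma> (f q s) \<le> (b + 1) / 2" if "s \<in> {0..x}" for s
      using recip_bounds[of "f q s"] f_bounds[OF q, of s] that x by auto
    have "integral {0..x} (\<lambda>s. (b - 1) / 2) \<le> T q x"
      unfolding T_def by (intro integral_le int_r q x) (use r in \<open>fastforce simp: field_simps\<close>)+
    moreover have "T q x \<le> integral {0..x} (\<lambda>s. b)"
      unfolding T_def by (intro integral_le int_r q x) (use r in \<open>fastforce simp: field_simps\<close>)+
    ultimately show "T q x \<in> {(b - 1) / 2 * x..b * x}"
      using x by (simp add: mult.commute)
  qed
  have contr: "\<bar>T q x - T r x\<bar> \<le> (4 * \<tau>) * d"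
    if qr: "q \<in> S" "r \<in> S" and d: "\<And>x. x \<in> {0..L} \<Longrightarrow> \<bar>q x - r x\<bar> \<le> d" and x: "x \<in> {0..L}" for q r d x
  proof -
    have "0 \<le> d" using d[OF x] by simp
    have cont: "continuous_on {0..L} (\<lambda>s. \<bar>f q s - f r s\<bar>)"
      using cont_f qr by (intro continuous_intros) auto
    have cont_qr: "continuous_on {0..L} q" "continuous_on {0..L} r" using qr by (auto simp: S_def)
    have int: "(\<lambda>s. 4 * \<bar>f q s - f r s\<bar>) integrable_on {0..y}" if "y \<in> {0..L}" for y
      by (intro integrable_continuous_interval continuous_intros continuous_on_subset[OF cont]) (use that in auto)
    have "T q x - T r x = integral {0..x} (\<lambda>s. (b - recip \<sigma> (f q s)) - (b - recip \<sigma> (f r s)))"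
      unfolding T_def by (rule integral_diff[symmetric]; rule int_r[OF _ x]; fact)
    also have "norm \<dots> \<le> integral {0..x} (\<lambda>s. 4 * \<bar>f q s - f r s\<bar>)"
    proof (rule integral_norm_bound_integral)
      show "norm ((b - recip \<sigma> (f q s)) - (b - recip \<sigma> (f r s))) \<le> 4 * \<bar>f q s - f r s\<bar>" if "s \<in> {0..x}" for s
        using recip_dist[of "f q s" "f r s"] f_bounds[OF qr(1), of s] f_bounds[OF qr(2), of s] that x
        by (simp add: abs_minus_commute)
    qed (intro integrable_diff int_r qr x int)+
    also have "\<dots> \<le> integral {0..L} (\<lambda>s. 4 * \<bar>f q s - f r s\<bar>)"
      by (rule integral_subset_le) (use x L int in auto)
    also have "\<dots> = 4 * integral {0..L} (\<lambda>s. \<bar>f q s - f r s\<bar>)" by simp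
    also have "\<dots> \<le> 4 * (\<tau> * integral {0..L} (\<lambda>s. \<bar>q s - r s\<bar>))"
      unfolding f_def by (intro mult_left_mono integral_solution_dist_le cont_qr hsol qr) auto
    also have "integral {0..L} (\<lambda>s. \<bar>q s - r s\<bar>) \<le> integral {0..L} (\<lambda>s. d)"
      using d cont_qr by (intro integral_le integrable_continuous_interval continuous_intros) auto
    also have "\<dots> = L * d" using L by simp
    also have "L * d \<le> 1 * d" using L \<open>0 \<le> d\<close> by (intro mult_right_mono) auto
    finally show ?thesis using tau by (simp add: mult_ac)
  qed
  have "\<exists>q\<in>S. \<forall>x\<in>{0..L}. T q x = q x"
    unfolding S_def
  proof (rule continuous_fixed_point[where c = "4 * \<tau>" and ?u0.0 = "\<lambda>x. b * x"])
    show "(\<lambda>x. b * x) \<in> {q. continuous_on {0..L} q \<and> (\<forall>x\<in>{0..L}. q x \<in> {(b - 1) / 2 * x..b * x})}"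
    proof -
      have "(b - 1) / 2 * x \<le> b * x" if "0 \<le> x" for x
        using b that by (intro mult_right_mono) auto
      then show ?thesis by (auto intro!: continuous_intros simp del: times_divide_eq_left)
    qed
  qed (use tau tau_less TS contr in \<open>auto simp: S_def\<close>)
  then obtain q where q: "q \<in> S" "\<And>x. x \<in> {0..L} \<Longrightarrow> T q x = q x" by blast
  show ?thesis
  proof (rule that[OF hsol[OF q(1)]])
    show "q 0 = 0" using q(2)[of 0] L by (simp add: T_def)
    show "(b - 1) / 2 * x \<le> q x \<and> q x \<le> b * x" if "x \<in> {0..L}" for x
      using q(1) that by (auto simp: S_def)
    show "(q has_real_derivative b - recip \<sigma> (potential_inv \<sigma> (hsol q x))) (at x within {0..L})"
      if x: "x \<in> {0..L}" for x
      using has_field_derivative_transform_within[OF der_T[OF q(1) x] zero_less_one x] q(2) by (simp add: f_def)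
  qed
qed

end

section \<open>The slope at the sonic point\<close>

text \<open>If \<open>p\<close> were at least \<open>\<alpha>\<close> at a tiny \<open>x\<close>, it
  would remain so and gain at least \<open>c * ln (y / x)\<close> up to a fixed \<open>y\<close>,
  exceeding \<open>M\<close>.\<close>

lemma eventually_less_of_log_growth:
  fixes p :: "real \<Rightarrow> real"
  assumes "0 < \<delta>" "0 < c"
    and der: "\<And>x. 0 < x \<Longrightarrow> x < \<delta> \<Longrightarrow> (p has_real_derivative p' x) (at x)"
    and growth: "\<And>x. 0 < x \<Longrightarrow> x < \<delta> \<Longrightarrow> \<alpha> \<le> p x \<Longrightarrow> c / x \<le> p' x"
    and bound: "\<And>x. 0 < x \<Longrightarrow> x < \<delta> \<Longrightarrow> p x \<le> M"
  shows "\<forall>\<^sub>F x in at_right 0. p x < \<alpha>"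
proof -
  define y where "y = \<delta> / 2"
  \<comment> \<open>For smaller \<open>x\<close> the value \<open>\<alpha> + c * ln (y / x)\<close>
    exceeds \<open>M\<close>; the minimum with \<open>y\<close> covers the case
    \<open>M < \<alpha>\<close>.\<close>
  define r where "r = min y (y * exp (- (M - \<alpha>) / c))"
  have y: "0 < y" "y < \<delta>" and r: "0 < r" using assms by (auto simp: y_def r_def)
  have cont: "continuous_on {u..v} p" if "0 < u" "v < \<delta>" for u v
    by (rule DERIV_continuous_on, rule has_field_derivative_at_within, rule der) (use that in auto)
  have "p x < \<alpha>" if x: "0 < x" "x < r" for x
  proof (rule ccontr)
    assume "\<not> p x < \<alpha>"
    have xy: "x < y" using x by (simp add: r_def)
    \<comment> \<open>At the last point \<open>z\<close> before \<open>t\<close> where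
      \<open>p\<close> is at least \<open>\<alpha>\<close> the derivative is positive, so
      \<open>p\<close> rises just after \<open>z\<close>, which was therefore not the last.\<close>
    have stay: "\<alpha> \<le> p t" if t: "x \<le> t" "t \<le> y" for t
    proof (rule ccontr)
      assume less: "\<not> \<alpha> \<le> p t"
      have "compact ({x..t} \<inter> p -` {\<alpha>..})"
        unfolding compact_eq_bounded_closed
      proof
        show "closed ({x..t} \<inter> p -` {\<alpha>..})"
          by (rule continuous_closed_preimage[OF cont]) (use x t y in auto)
      qed (simp add: bounded_Int)
      moreover have "x \<in> {x..t} \<inter> p -` {\<alpha>..}" using \<open>\<not> p x < \<alpha>\<close> t by simp
      ultimately obtain z where z: "z \<in> {x..t} \<inter> p -` {\<alpha>..}" and zmax: "\<And>s. s \<in> {x..t} \<inter> p -` {\<alpha>..} \<Longrightarrow> s \<le> z"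
        using compact_attains_sup by (metis empty_iff)
      have z': "0 < z" "z < \<delta>" "z < t" "\<alpha> \<le> p z" using z x t y less by (cases "z = t"; auto)+
      have "0 < c / z" using z' assms by simp
      then have "p' z > 0" using growth[of z] z' by linarith
      then obtain d where d: "d > 0" "\<And>h. 0 < h \<Longrightarrow> h < d \<Longrightarrow> p z < p (z + h)"
        using DERIV_pos_inc_right[OF der[OF z'(1,2)]] by blast
      define h where "h = min (d / 2) (t - z)"
      have h: "0 < h" "h < d" "z + h \<le> t" using d(1) z' by (auto simp: h_def min_def)
      have "z + h \<le> z" using zmax[of "z + h"] d(2)[of h] h z z' by auto
      with h show False by simp
    qed
    have "p x - c * ln x \<le> p y - c * ln y"
    proof (rule DERIV_nonneg_imp_nondecreasing[of x y])
      fix t assume t: "x \<le> t" "t \<le> y"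
      then have t': "0 < t" "t < \<delta>" using x y by auto
      have "((\<lambda>t. p t - c * ln t) has_real_derivative p' t - c / t) (at t)"
        using t' by (auto intro!: derivative_eq_intros der)
      then show "\<exists>D. ((\<lambda>t. p t - c * ln t) has_real_derivative D) (at t) \<and> 0 \<le> D"
        using growth[OF t' stay[OF t]] by (intro exI[of _ "p' t - c / t"]) auto
    qed (use xy in simp)
    moreover have "p y \<le> M" using bound y by blast
    ultimately have "\<alpha> - c * ln x \<le> M - c * ln y"
      using \<open>\<not> p x < \<alpha>\<close> by linarith
    then have "ln y + - (M - \<alpha>) / c \<le> ln x"
      using \<open>0 < c\<close> by (simp add: field_simps)
    then have "exp (ln y + - (M - \<alpha>) / c) \<le> exp (ln x)" by (simp only: exp_le_cancel_iff)
    then have "y * exp (- (M - \<alpha>) / c) \<le> x" using x y by (simp add: exp_add)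
    then show False using x by (simp add: r_def)
  qed
  then show ?thesis using r by (auto simp: eventually_at_right_field)
qed

section \<open>The two slopes of the sonic node and the limit of the quotient\<close>

context profile
begin

definition slope :: real where
  "slope = 1/4 * (1/\<tau> - sqrt (1/\<tau>\<^sup>2 - 8 * (b - 1)))"

definition fast_slope :: real where
  "fast_slope = 1/4 * (1/\<tau> + sqrt (1/\<tau>\<^sup>2 - 8 * (b - 1)))"

lemma tau_sq_less: "16 * b * \<tau>\<^sup>2 < 1"
proof -
  have "(4 * b * \<tau>) * (4 * \<tau>) \<le> 1 * (4 * \<tau>)" using tau by (intro mult_right_mono) auto
  moreover have "16 * b * \<tau>\<^sup>2 = (4 * b * \<tau>) * (4 * \<tau>)" by (simp add: power2_eq_square)
  ultimately show ?thesis using tau_less by linarith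
qed

lemma slope_discriminant: "0 < 1/\<tau>\<^sup>2 - 8 * (b - 1)"
proof -
  have "8 * (b - 1) * \<tau>\<^sup>2 \<le> 16 * b * \<tau>\<^sup>2" using b by (intro mult_right_mono) auto
  then have "8 * (b - 1) * \<tau>\<^sup>2 < 1" using tau_sq_less by linarith
  then show ?thesis using tau by (simp add: field_simps)
qed

lemma slope_factor: "x / \<tau> - (b - 1) - 2 * x\<^sup>2 = 2 * (x - slope) * (fast_slope - x)"
proof -
  define D where "D = sqrt (1/\<tau>\<^sup>2 - 8 * (b - 1))"
  define i where "i = 1 / \<tau>"
  have "D\<^sup>2 = i\<^sup>2 - 8 * (b - 1)"
    unfolding D_def i_def using slope_discriminant by (simp add: power_one_over)
  then have *: "b - 1 = (i\<^sup>2 - D\<^sup>2) / 8" by simp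
  have "x / \<tau> = x * i" by (simp add: i_def)
  then show ?thesis
    unfolding slope_def fast_slope_def D_def[symmetric] i_def[symmetric]
    unfolding *
    by (simp add: field_simps power2_eq_square)
qed

lemma slope_pos: "0 < slope"
proof -
  have "sqrt (1/\<tau>\<^sup>2 - 8 * (b - 1)) < 1 / \<tau>"
    using b tau slope_discriminant by (intro real_less_lsqrt) (auto simp: power_one_over)
  then show ?thesis by (simp add: slope_def)
qed

text \<open>Since \<open>8 * b * \<tau>\<^sup>2 < 1\<close>, the barrier slope lies below
  \<open>1 / (4 * \<tau>)\<close>, the midpoint of the two roots. This gap excludes an approach
  along the larger root.\<close>

lemma slope_bound_less: "slope_bound < fast_slope"
proof -
  have "8 * b * \<tau>\<^sup>2 < 1"
  proof -
    have "0 < b * \<tau>\<^sup>2" using b tau by simp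
    then show ?thesis using tau_sq_less by linarith
  qed
  then have "2 * b * \<tau> < 1 / (4 * \<tau>)"
    using tau by (simp add: field_simps power2_eq_square)
  moreover have "0 \<le> sqrt (1/\<tau>\<^sup>2 - 8 * (b - 1))" using slope_discriminant by simp
  moreover have "1 / (4 * \<tau>) = 1/4 * (1/\<tau>)" by simp
  ultimately show ?thesis unfolding slope_bound_def fast_slope_def distrib_left by linarith
qed


text \<open>The quotient \<open>p = f/x\<close> satisfies \<open>x p' = N/(p m)\<close>, where \<open>m \<rightarrow> 2\<close> and \<open>N\<close> is asymptotically
  \<open>2 (p - slope) (fast_slope - p)\<close>. Away from \<open>slope\<close> it would therefore drift logarithmically as
  \<open>x\<close> varies, which boundedness forbids near \<open>0\<close>.\<close>
lemma slope_limit: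
  fixes f q :: "real \<Rightarrow> real"
  assumes pos: "\<And>x. x \<in> {0<..<L} \<Longrightarrow> 0 < f x" and le: "\<And>x. x \<in> {0<..<L} \<Longrightarrow> f x \<le> slope_bound * x"
    and der: "\<And>x. x \<in> {0<..<L} \<Longrightarrow> (f has_real_derivative (f x / \<tau> - q x) / potential' \<sigma> (f x)) (at x)"
    and q: "((\<lambda>x. q x / x) \<longlongrightarrow> b - 1) (at_right 0)"
  shows "((\<lambda>x. f x / x) \<longlongrightarrow> slope) (at_right 0)"
    and "((\<lambda>x. (f x / \<tau> - q x) / potential' \<sigma> (f x)) \<longlongrightarrow> slope) (at_right 0)"
proof -
  define p where "p x = f x / x" for x
  define m where "m x = (2 - \<sigma> * f x) / (1 - \<sigma> * f x)" for x
  define N where "N x = p x / \<tau> - q x / x - m x * (p x)\<^sup>2" for x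
  define p' where "p' x = N x / (p x * m x) / x" for x
  define k where "k = slope_bound"
  have k: "0 < k" "k \<le> 1/2" "k < fast_slope" using slope_bound slope_bound_less by (auto simp: k_def)
  have f: "0 < f x" "f x \<le> 1/2" if "x \<in> {0<..<L}" for x
  proof -
    have "slope_bound * x \<le> 1/2 * 1" using that L slope_bound by (intro mult_mono) auto
    then show "0 < f x" "f x \<le> 1/2" using pos[OF that] le[OF that] by auto
  qed
  have p: "0 < p x" "p x \<le> k" if "x \<in> {0<..<L}" for x
    using that f[OF that] le[OF that] by (auto simp: p_def k_def field_simps)
  have m: "1 \<le> m x" "m x \<le> 3" if "x \<in> {0<..<L}" for x
    using denom_ge[of "f x"] f[OF that] sigma by (auto simp: m_def field_simps)
  have f'_eq: "(f x / \<tau> - q x) / potential' \<sigma> (f x) = (p x / \<tau> - q x / x) / (p x * m x)" if "x \<in> {0<..<L}" for x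
  proof -
    have "potential' \<sigma> (f x) = x * (p x * m x)"
      using potential'_eq[of "f x"] f[OF that] that by (simp add: p_def m_def)
    moreover have "f x / \<tau> - q x = x * (p x / \<tau> - q x / x)"
      using that tau by (simp add: p_def field_simps)
    ultimately show ?thesis using that by simp
  qed
  have der_p: "(p has_real_derivative p' x) (at x)" if "x \<in> {0<..<L}" for x
  proof -
    have "(p has_real_derivative ((p x / \<tau> - q x / x) / (p x * m x) * x - f x * 1) / (x * x)) (at x)"
      unfolding p_def [abs_def] using der[OF that, unfolded f'_eq[OF that]] that
      by (intro DERIV_divide) (auto simp: p_def)
    moreover have "((p x / \<tau> - q x / x) / (p x * m x) * x - f x * 1) / (x * x) = p' x"
    proof -
      have "f x = p x * x" using that by (simp add: p_def)
      then have "((p x / \<tau> - q x / x) / (p x * m x) * x - f x * 1) / (x * x)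
          = ((p x / \<tau> - q x / x) / (p x * m x) - p x) / x"
      proof -
        have "(a * x - c * x * 1) / (x * x) = (a - c) / x" for a c :: real
          using that by (simp flip: left_diff_distrib)
        then show ?thesis unfolding \<open>f x = p x * x\<close> .
      qed
      also have "(p x / \<tau> - q x / x) / (p x * m x) - p x = N x / (p x * m x)"
        using p[OF that] m[OF that] by (simp add: N_def diff_divide_distrib power2_eq_square)
      finally show ?thesis by (simp add: p'_def)
    qed
    ultimately show ?thesis by simp
  qed
  have L0: "\<forall>\<^sub>F x in at_right 0. x \<in> {0<..<L}"
    using L by (auto simp: eventually_at_right_field)
  have f0: "(f \<longlongrightarrow> 0) (at_right 0)"
  proof (rule tendsto_sandwich)
    show "\<forall>\<^sub>F x in at_right 0. 0 \<le> f x" "\<forall>\<^sub>F x in at_right 0. f x \<le> k * x"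
      using L0 by (eventually_elim; use pos le in \<open>force simp: k_def\<close>)+
    show "((\<lambda>x. k * x) \<longlongrightarrow> 0) (at_right 0)"
      by (auto intro!: tendsto_eq_intros)
  qed auto
  have m0: "(m \<longlongrightarrow> 2) (at_right 0)"
    unfolding m_def [abs_def] by (auto intro!: tendsto_eq_intros f0)
  \<comment> \<open>The error comes from \<open>q x / x\<close> deviating from \<open>b - 1\<close>
    and \<open>m x\<close> from 2; the latter deviation is multiplied by
    \<open>(p x)\<^sup>2 \<le> 1\<close>.\<close>
  have gap: "\<forall>\<^sub>F x in at_right 0. \<bar>N x - 2 * ((p x - slope) * (fast_slope - p x))\<bar> < \<eta>" if "\<eta> > 0" for \<eta>
  proof -
    have "((\<lambda>x. \<bar>q x / x - (b - 1)\<bar> + \<bar>m x - 2\<bar>) \<longlongrightarrow> \<bar>(b - 1) - (b - 1)\<bar> + \<bar>2 - 2\<bar>) (at_right 0)"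
      by (intro tendsto_intros q m0)
    then have "\<forall>\<^sub>F x in at_right 0. \<bar>q x / x - (b - 1)\<bar> + \<bar>m x - 2\<bar> < \<eta>"
      using that by (intro order_tendstoD) auto
    then show ?thesis using L0
    proof eventually_elim
      case (elim x)
      have "(p x)\<^sup>2 \<le> 1\<^sup>2" using p[OF elim(2)] k by (intro power_mono) auto
      then have le: "\<bar>(m x - 2) * (p x)\<^sup>2\<bar> \<le> \<bar>m x - 2\<bar> * 1"
        unfolding abs_mult by (intro mult_left_mono) auto
      have "N x - 2 * ((p x - slope) * (fast_slope - p x)) = - (q x / x - (b - 1)) - (m x - 2) * (p x)\<^sup>2"
        unfolding mult.assoc[symmetric] slope_factor[symmetric] N_def by (simp add: algebra_simps)
      also have "\<bar>\<dots>\<bar> \<le> \<bar>q x / x - (b - 1)\<bar> + \<bar>(m x - 2) * (p x)\<^sup>2\<bar>"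
        using abs_triangle_ineq4[of "- (q x / x - (b - 1))"] by (simp only: abs_minus_cancel)
      also have "\<dots> \<le> \<bar>q x / x - (b - 1)\<bar> + \<bar>m x - 2\<bar>"
        using le by simp
      also note elim(1)
      finally show ?case .
    qed
  qed
  have lim_p: "(p \<longlongrightarrow> slope) (at_right 0)"
  proof (rule order_tendstoI)
    fix \<alpha> assume "slope < \<alpha>"
    \<comment> \<open>For \<open>p x \<ge> \<alpha>\<close> the main term of \<open>N x\<close> is
      at least \<open>2 * \<eta>\<close>, because \<open>p x \<le> k\<close> keeps away from
      \<open>fast_slope\<close>; the error costs at most \<open>\<eta>\<close>. Dividing by
      \<open>p x * m x \<le> k * 3\<close> gives the growth constant.\<close>
    define \<eta> where "\<eta> = (\<alpha> - slope) * (fast_slope - k)"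
    have \<eta>: "\<eta> > 0" using \<open>slope < \<alpha>\<close> k by (simp add: \<eta>_def)
    obtain \<delta> where \<delta>: "\<delta> > 0" "\<And>x. 0 < x \<Longrightarrow> x < \<delta> \<Longrightarrow> \<bar>N x - 2 * ((p x - slope) * (fast_slope - p x))\<bar> < \<eta> \<and> x \<in> {0<..<L}"
      using eventually_conj[OF gap[OF \<eta>] L0] by (auto simp: eventually_at_right_field)
    show "\<forall>\<^sub>F x in at_right 0. p x < \<alpha>"
    proof (rule eventually_less_of_log_growth[OF \<delta>(1)])
      show "0 < \<eta> / (k * 3)" using \<eta> k by simp
      fix x assume x: "0 < x" "x < \<delta>"
      note x' = \<delta>(2)[OF x, THEN conjunct2]
      show "(p has_real_derivative p' x) (at x)" by (rule der_p[OF x'])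
      show "p x \<le> k" using p(2)[OF x'] .
      assume \<alpha>: "\<alpha> \<le> p x"
      have "(\<alpha> - slope) * (fast_slope - k) \<le> (p x - slope) * (fast_slope - p x)"
        using \<alpha> \<open>slope < \<alpha>\<close> p(2)[OF x'] k by (intro mult_mono) auto
      then have "\<eta> \<le> N x"
        using \<delta>(2)[OF x, THEN conjunct1] unfolding \<eta>_def abs_less_iff by linarith
      moreover have "p x * m x \<le> k * 3" using p[OF x'] m[OF x'] k by (intro mult_mono) auto
      ultimately have "\<eta> / (k * 3) \<le> N x / (p x * m x)"
        using \<eta> p[OF x'] m[OF x'] by (intro frac_le) auto
      then show "\<eta> / (k * 3) / x \<le> p' x"
        unfolding p'_def using x by (intro divide_right_mono) auto
    qed
  next
    fix \<alpha> assume "\<alpha> < slope"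
    define \<eta> where "\<eta> = (slope - \<alpha>) * (fast_slope - k)"
    have \<eta>: "\<eta> > 0" using \<open>\<alpha> < slope\<close> k by (simp add: \<eta>_def)
    obtain \<delta> where \<delta>: "\<delta> > 0" "\<And>x. 0 < x \<Longrightarrow> x < \<delta> \<Longrightarrow> \<bar>N x - 2 * ((p x - slope) * (fast_slope - p x))\<bar> < \<eta> \<and> x \<in> {0<..<L}"
      using eventually_conj[OF gap[OF \<eta>] L0] by (auto simp: eventually_at_right_field)
    \<comment> \<open>The same argument for \<open>- p\<close>, whose upper bound 0 comes from
      positivity of \<open>p\<close>.\<close>
    have "\<forall>\<^sub>F x in at_right 0. - p x < - \<alpha>"
    proof (rule eventually_less_of_log_growth[OF \<delta>(1)])
      show "0 < \<eta> / (k * 3)" using \<eta> k by simp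
      fix x assume x: "0 < x" "x < \<delta>"
      note x' = \<delta>(2)[OF x, THEN conjunct2]
      show "((\<lambda>x. - p x) has_real_derivative - p' x) (at x)" by (rule DERIV_minus[OF der_p[OF x']])
      show "- p x \<le> 0" using p(1)[OF x'] by simp
      assume \<alpha>: "- \<alpha> \<le> - p x"
      have "(slope - \<alpha>) * (fast_slope - k) \<le> (slope - p x) * (fast_slope - p x)"
        using \<alpha> \<open>\<alpha> < slope\<close> p(2)[OF x'] k by (intro mult_mono) auto
      also have "\<dots> = - ((p x - slope) * (fast_slope - p x))" by (simp flip: mult_minus_left)
      finally have "\<eta> \<le> - N x"
        using \<delta>(2)[OF x, THEN conjunct1] unfolding \<eta>_def abs_less_iff by linarith
      moreover have "p x * m x \<le> k * 3" using p[OF x'] m[OF x'] k by (intro mult_mono) auto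
      ultimately have "\<eta> / (k * 3) \<le> - N x / (p x * m x)"
        using \<eta> p[OF x'] m[OF x'] by (intro frac_le) auto
      then have "\<eta> / (k * 3) / x \<le> - N x / (p x * m x) / x"
        using x by (intro divide_right_mono) auto
      then show "\<eta> / (k * 3) / x \<le> - p' x"
        by (simp add: p'_def)
    qed
    then show "\<forall>\<^sub>F x in at_right 0. \<alpha> < p x" by simp
  qed
  then show "((\<lambda>x. f x / x) \<longlongrightarrow> slope) (at_right 0)" by (simp add: p_def [abs_def])
  have "((\<lambda>x. (p x / \<tau> - q x / x) / (p x * m x)) \<longlongrightarrow> (slope / \<tau> - (b - 1)) / (slope * 2)) (at_right 0)"
    using slope_pos tau by (intro tendsto_intros lim_p q m0) auto
  \<comment> \<open>As a root of the quadratic, \<open>slope\<close> satisfies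
    \<open>slope / \<tau> - (b - 1) = 2 * slope\<^sup>2\<close>.\<close>
  also have "(slope / \<tau> - (b - 1)) / (slope * 2) = slope"
    using slope_factor[of slope] slope_pos tau by (simp add: field_simps power2_eq_square)
  finally have "((\<lambda>x. (p x / \<tau> - q x / x) / (p x * m x)) \<longlongrightarrow> slope) (at_right 0)" .
  then show "((\<lambda>x. (f x / \<tau> - q x) / potential' \<sigma> (f x)) \<longlongrightarrow> slope) (at_right 0)"
    by (rule Lim_transform_eventually) (use L0 f'_eq in \<open>auto elim!: eventually_mono\<close>)
qed

section \<open>Returning from the potential to the profile\<close>

lemma has_derivative_potential_inv:
  assumes "0 < h" "h < potential \<sigma> (1/2)"
  shows "(potential_inv \<sigma> has_real_derivative inverse (potential' \<sigma> (potential_inv \<sigma> h))) (at h)"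
proof (rule DERIV_inverse_function[where a = 0 and b = "potential \<sigma> (1/2)" and f = "potential \<sigma>"])
  show "(potential \<sigma> has_real_derivative potential' \<sigma> (potential_inv \<sigma> h)) (at (potential_inv \<sigma> h))"
    by (intro has_derivative_potential potential_inv_nonneg potential_inv_le)
  show "potential' \<sigma> (potential_inv \<sigma> h) \<noteq> 0"
    using potential'_bounds(1)[of "potential_inv \<sigma> h"] potential_inv_nonneg[of h] potential_inv_le[of h] potential_inv_pos[OF assms(1)]
    by simp
  show "isCont (potential_inv \<sigma>) h"
    using uniformly_continuous_imp_continuous[OF uniformly_continuous_potential_inv]
    by (simp add: continuous_on_eq_continuous_at)
qed (use assms in \<open>auto simp: potential_inv(2)\<close>)

text \<open>Strict bounds on \<open>h\<close> in the interior make the inverse potential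
  differentiable along the solution; \<open>h 0 = 0\<close> gives \<open>q x / x\<close> the limit
  \<open>b - 1\<close>, and \<open>slope_limit\<close> then applies.\<close>

lemma transonic_profile:
  obtains f q where
    "continuous_on {0..L} f" "f 0 = 0" "f L = 0" "q 0 = 0"
    "\<And>x. x \<in> {0..L} \<Longrightarrow> 0 \<le> f x \<and> f x \<le> 1/2"
    "\<And>x. x \<in> {0<..<L} \<Longrightarrow> 0 < f x"
    "\<And>x. x \<in> {0<..<L} \<Longrightarrow> (f has_real_derivative (f x / \<tau> - q x) / potential' \<sigma> (f x)) (at x)"
    "\<And>x. x \<in> {0..L} \<Longrightarrow> (q has_real_derivative b - recip \<sigma> (f x)) (at x within {0..L})"
    "((\<lambda>x. f x / x) \<longlongrightarrow> slope) (at_right 0)"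
    "((\<lambda>x. (f x / \<tau> - q x) / potential' \<sigma> (f x)) \<longlongrightarrow> slope) (at_right 0)"
proof -
  obtain q h where h: "solves_for q h" and q0: "q 0 = 0"
    and q: "\<And>x. x \<in> {0..L} \<Longrightarrow> (b - 1) / 2 * x \<le> q x \<and> q x \<le> b * x"
    and q': "\<And>x. x \<in> {0..L} \<Longrightarrow> (q has_real_derivative b - recip \<sigma> (potential_inv \<sigma> (h x))) (at x within {0..L})"
    by (rule profile_exists) blast
  define f where "f x = potential_inv \<sigma> (h x)" for x
  have qb: "0 \<le> q x \<and> q x \<le> b * x" if "x \<in> {0..L}" for x
  proof -
    have "0 \<le> (b - 1) / 2 * x" using b that by simp
    then show ?thesis using q[OF that] by linarith
  qed
  note h_bounds = solves_for_bounds[OF h qb]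
  have f_le: "f x \<le> slope_bound * x" if "x \<in> {0..L}" for x
    unfolding f_def by (rule potential_inv_solution_le[OF h qb that])
  have h0: "h 0 = 0" using h_bounds[of 0] L by simp
  have der_h: "(h has_real_derivative f x / \<tau> - q x) (at x)" if "x \<in> {0<..<L}" for x
    using solves_forD(2)[OF h, of x] that by (simp add: f_def at_within_Icc_at)
  have h_pos: "0 < h x" if x: "x \<in> {0<..<L}" for x
  proof (rule ccontr)
    assume "\<not> 0 < h x"
    then have hx: "h x = 0" using h_bounds(1)[of x] x by simp
    \<comment> \<open>An interior zero would be a minimum of \<open>h\<close>, where the equation
      reads \<open>- q x = 0\<close>, although \<open>q\<close> is positive there.\<close>
    have "f x / \<tau> - q x = 0"
    proof (rule DERIV_local_min[OF der_h[OF x]])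
      show "0 < min x (L - x)" using x by simp
      show "\<forall>y. \<bar>x - y\<bar> < min x (L - x) \<longrightarrow> h x \<le> h y"
        using h_bounds(1) hx by (auto simp: abs_less_iff)
    qed
    moreover have "0 < (b - 1) / 2 * x" using b x by simp
    ultimately show False using q[of x] x hx by (simp add: f_def)
  qed
  have h_less: "h x < potential \<sigma> (1/2)" if x: "x \<in> {0<..<L}" for x
  proof -
    have "slope_bound * x < 1/2 * 1"
      using x L slope_bound by (intro mult_le_less_imp_less) auto
    moreover have "0 \<le> slope_bound * x" using x slope_bound by simp
    ultimately have "potential \<sigma> (slope_bound * x) < potential \<sigma> (1/2)"
      by (intro potential_strict_mono) auto
    then show ?thesis using h_bounds(2)[of x] x by simp
  qed
  have f_pos: "0 < f x" if "x \<in> {0<..<L}" for x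
    unfolding f_def by (rule potential_inv_pos[OF h_pos[OF that]])
  have der_f: "(f has_real_derivative (f x / \<tau> - q x) / potential' \<sigma> (f x)) (at x)" if x: "x \<in> {0<..<L}" for x
    using DERIV_chain2[OF has_derivative_potential_inv[OF h_pos[OF x] h_less[OF x]] der_h[OF x]]
    by (simp add: f_def [abs_def] field_simps)
  have "((\<lambda>x. (q x - q 0) / (x - 0)) \<longlongrightarrow> b - recip \<sigma> (f 0)) (at 0 within {0..L})"
    using q'[of 0] L by (simp add: has_field_derivative_iff f_def)
  then have q_lim: "((\<lambda>x. q x / x) \<longlongrightarrow> b - 1) (at_right 0)"
    using L by (simp add: q0 f_def h0 recip_def at_within_Icc_at_right)
  show ?thesis
  proof (rule that)
    show "continuous_on {0..L} f" unfolding f_def by (rule continuous_potential_inv_solution[OF h])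
    show "f 0 = 0" "f L = 0" by (simp_all add: f_def h0 solves_forD(1)[OF h])
    show "0 \<le> f x \<and> f x \<le> 1/2" if "x \<in> {0..L}" for x
      unfolding f_def using potential_inv_nonneg potential_inv_le by blast
    show "(q has_real_derivative b - recip \<sigma> (f x)) (at x within {0..L})" if "x \<in> {0..L}" for x
      unfolding f_def by (rule q'[OF that])
    show "((\<lambda>x. f x / x) \<longlongrightarrow> slope) (at_right 0)"
      "((\<lambda>x. (f x / \<tau> - q x) / potential' \<sigma> (f x)) \<longlongrightarrow> slope) (at_right 0)"
      by (rule slope_limit[OF f_pos f_le der_f q_lim]; simp)+
  qed (fact q0 f_pos der_f)+
qed

end

section \<open>Weak derivatives\<close>

lemma set_integrable_of_continuous:
  fixes u :: "real \<Rightarrow> real"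
  assumes "continuous_on {l..r} u" "S \<in> sets lebesgue" "S \<subseteq> {l..r}"
  shows "set_integrable lebesgue S u"
  using absolutely_integrable_continuous_real[OF assms(1)] assms(2,3) by (rule set_integrable_subset)

lemma locally_integrable_of_continuous:
  assumes "continuous_on {l..r} u"
  shows "locally_integrable {l<..<r} u"
  unfolding locally_integrable_def
proof (intro allI impI)
  fix K assume K: "compact K \<and> K \<subseteq> {l<..<r}"
  then have "K \<subseteq> {l..r}" by fastforce
  with K show "set_integrable lebesgue K u"
    by (intro set_integrable_of_continuous[OF assms]) (auto intro: lmeasurable_compact fmeasurableD)
qed

lemma in_L2_of_continuous:
  assumes "continuous_on {l..r} u"
  shows "in_L2 {l<..<r} u"
  unfolding in_L2_def
proof
  have "set_integrable lebesgue {l<..<r} u"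
    by (intro set_integrable_of_continuous[OF assms]) auto
  then show "set_borel_measurable lebesgue {l<..<r} u"
    unfolding set_integrable_def set_borel_measurable_def by (rule borel_measurable_integrable)
  show "set_integrable lebesgue {l<..<r} (\<lambda>x. (u x)\<^sup>2)"
    by (intro set_integrable_of_continuous[where l = l and r = r] continuous_intros assms) auto
qed

text \<open>Integration by parts against a test function, which vanishes at \<open>l\<close> and
  \<open>r\<close> because its support is compact in the open interval. The fundamental theorem asks
  for the derivative only in the interior.\<close>

lemma has_weak_derivative_of_C1:
  fixes u w :: "real \<Rightarrow> real"
  assumes "l < r" and u: "continuous_on {l..r} u" and w: "continuous_on {l..r} w"
    and der: "\<And>x. x \<in> {l<..<r} \<Longrightarrow> (u has_real_derivative w x) (at x)"
  shows "has_weak_derivative u w {l<..<r}"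
  unfolding has_weak_derivative_def
proof (intro conjI allI impI)
  show "locally_integrable {l<..<r} u" "locally_integrable {l<..<r} w"
    by (intro locally_integrable_of_continuous u w)+
  fix \<phi> assume "test_function {l<..<r} \<phi>"
  then have diff: "\<And>n x. (deriv ^^ n) \<phi> differentiable (at x)" and bdry: "\<phi> l = 0" "\<phi> r = 0"
    unfolding test_function_def by (force simp: subset_eq)+
  have phi: "(\<phi> has_real_derivative deriv \<phi> x) (at x)" for x
    using diff[of 0 x] by (simp add: DERIV_deriv_iff_real_differentiable)
  then have cont: "continuous_on {l..r} \<phi>"
    by (intro DERIV_continuous_on) (rule has_field_derivative_at_within)
  have cont': "continuous_on {l..r} (deriv \<phi>)"
    using diff[of 1] by (intro differentiable_imp_continuous_on differentiable_at_imp_differentiable_on) simp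
  have eq: "(LINT x:{l<..<r}|lebesgue. g x) = integral {l..r} g" if "continuous_on {l..r} g" for g :: "real \<Rightarrow> real"
    using set_lebesgue_integral_eq_integral(2)[OF set_integrable_of_continuous[OF that, of "{l<..<r}"]]
    by (force simp: integral_open_interval_real)
  have "((\<lambda>x. u x * deriv \<phi> x + w x * \<phi> x) has_integral u r * \<phi> r - u l * \<phi> l) {l..r}"
  proof (rule fundamental_theorem_of_calculus_interior)
    show "continuous_on {l..r} (\<lambda>x. u x * \<phi> x)" by (intro continuous_intros u cont)
    show "((\<lambda>x. u x * \<phi> x) has_vector_derivative u x * deriv \<phi> x + w x * \<phi> x) (at x)" if "x \<in> {l<..<r}" for x
      unfolding has_real_derivative_iff_has_vector_derivative[symmetric]
      by (rule derivative_eq_intros der[OF that] phi refl)+ (simp add: mult.commute)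
  qed (use \<open>l < r\<close> in simp)
  then have "integral {l..r} (\<lambda>x. u x * deriv \<phi> x + w x * \<phi> x) = 0"
    by (simp add: integral_unique bdry)
  moreover have "integral {l..r} (\<lambda>x. u x * deriv \<phi> x + w x * \<phi> x)
      = integral {l..r} (\<lambda>x. u x * deriv \<phi> x) + integral {l..r} (\<lambda>x. w x * \<phi> x)"
    by (intro integral_add integrable_continuous_interval continuous_intros u w cont cont')
  ultimately show "(LINT x:{l<..<r}|lebesgue. u x * deriv \<phi> x) = - (LINT x:{l<..<r}|lebesgue. w x * \<phi> x)"
    by (subst (1 2) eq) (auto intro!: continuous_intros u w cont cont')
qed

text \<open>Working with \<open>(\<rho> - 1)\<^sup>2\<close> removes the sonic singularity: its
  derivative, expressed through \<open>E\<close>, has no division by \<open>\<rho> - 1\<close> and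
  is continuous up to both endpoints, even where the derivative of \<rho> blows up.\<close>

lemma solves_on_pieceI:
  assumes "l < r" and \<rho>: "continuous_on {l..r} \<rho>" and E: "continuous_on {l..r} E"
    and pos: "\<And>x. x \<in> {l..r} \<Longrightarrow> 0 < \<rho> x"
    and der_\<rho>: "\<And>x. x \<in> {l<..<r} \<Longrightarrow>
      ((\<lambda>x. (\<rho> x - 1)\<^sup>2) has_real_derivative 2 * \<rho> x ^ 3 / (\<rho> x + 1) * (E x - 1 / (\<tau> * \<rho> x))) (at x)"
    and der_E: "\<And>x. x \<in> {l<..<r} \<Longrightarrow> (E has_real_derivative \<rho> x - b) (at x)"
    and \<tau>: "\<tau> \<noteq> 0"
  shows "solves_on_piece b \<tau> l r \<rho> E"
proof -
  define w where "w x = 2 * \<rho> x ^ 3 / (\<rho> x + 1) * (E x - 1 / (\<tau> * \<rho> x))" for x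
  have nz: "\<rho> x \<noteq> 0" "\<rho> x + 1 \<noteq> 0" if "x \<in> {l..r}" for x
    using pos[OF that] by simp_all
  have w: "continuous_on {l..r} w"
    unfolding w_def using nz \<tau> by (intro continuous_intros \<rho> E) auto
  have u: "continuous_on {l..r} (\<lambda>x. (\<rho> x - 1)\<^sup>2)"
    by (intro continuous_intros \<rho>)
  have uw: "has_weak_derivative (\<lambda>x. (\<rho> x - 1)\<^sup>2) w {l<..<r}"
    by (rule has_weak_derivative_of_C1[OF \<open>l < r\<close> u w]) (use der_\<rho> in \<open>simp add: w_def\<close>)
  have "E x = (\<rho> x + 1) * w x / (2 * \<rho> x ^ 3) + 1 / (\<tau> * \<rho> x)" if "x \<in> {l<..<r}" for x
    using nz[of x] that by (simp add: w_def)
  moreover have "has_weak_derivative E (\<lambda>x. \<rho> x - b) {l<..<r}"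
    by (rule has_weak_derivative_of_C1[OF \<open>l < r\<close> E _ der_E]) (intro continuous_intros \<rho>)
  ultimately show ?thesis
    unfolding solves_on_piece_def in_H1_def
    using uw \<rho> E in_L2_of_continuous[OF u] in_L2_of_continuous[OF w]
    by (intro conjI exI[of _ w] exI[of _ "\<lambda>x. \<rho> x - b"]) (simp_all del: greaterThanLessThan_iff)
qed

section \<open>One piece in the physical variables\<close>

context profile
begin

text \<open>The affine map \<open>Y\<close> sends \<open>x0\<close> to 0 and the outer endpoint to
  \<open>L\<close>, reversing orientation when \<open>\<sigma> = -1\<close>, so one profile lemma
  serves both sides. The strict sign of \<open>\<rho> - 1\<close> is recorded to tell solutions
  apart later.\<close>

lemma transonic_piece:
  assumes lr: "\<sigma> = 1 \<and> l = x0 \<and> r = x0 + L \<or> \<sigma> = -1 \<and> l = x0 - L \<and> r = x0"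
  obtains \<rho> \<rho>' E where
    "solves_on_piece b \<tau> l r \<rho> E" "continuous_on {l..r} \<rho>" "\<rho> l = 1" "\<rho> r = 1" "E x0 = 1 / \<tau>"
    "\<And>x. x \<in> {l<..<r} \<Longrightarrow> 0 < \<rho> x \<and> 0 < \<sigma> * (\<rho> x - 1)"
    "\<And>x. x \<in> {l<..<r} \<Longrightarrow> (\<rho> has_real_derivative \<rho>' x) (at x)"
    "continuous_on {l<..<r} \<rho>'"
    "(\<rho> has_real_derivative slope) (at x0 within {l..r})"
    "(\<rho>' \<longlongrightarrow> slope) (at x0 within {l..r})"
proof -
  obtain f q where f: "continuous_on {0..L} f" "f 0 = 0" "f L = 0" and q0: "q 0 = 0"
    and f_bounds: "\<And>y. y \<in> {0..L} \<Longrightarrow> 0 \<le> f y \<and> f y \<le> 1/2"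
    and f_pos: "\<And>y. y \<in> {0<..<L} \<Longrightarrow> 0 < f y"
    and f': "\<And>y. y \<in> {0<..<L} \<Longrightarrow> (f has_real_derivative (f y / \<tau> - q y) / potential' \<sigma> (f y)) (at y)"
    and q': "\<And>y. y \<in> {0..L} \<Longrightarrow> (q has_real_derivative b - recip \<sigma> (f y)) (at y within {0..L})"
    and lim: "((\<lambda>y. f y / y) \<longlongrightarrow> slope) (at_right 0)"
    and lim': "((\<lambda>y. (f y / \<tau> - q y) / potential' \<sigma> (f y)) \<longlongrightarrow> slope) (at_right 0)"
    by (rule transonic_profile) blast
  define Y where "Y x = \<sigma> * (x - x0)" for x
  define \<rho> where "\<rho> x = recip \<sigma> (f (Y x))" for x
  define E where "E x = 1 / \<tau> - \<sigma> * q (Y x)" for x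
  define df where "df y = (f y / \<tau> - q y) / potential' \<sigma> (f y)" for y
  define \<rho>' where "\<rho>' x = (\<rho> x)\<^sup>2 * df (Y x)" for x
  have sq: "\<sigma> * \<sigma> = 1" using sigma by auto
  have Y: "Y x \<in> {0..L} \<longleftrightarrow> x \<in> {l..r}" "Y x \<in> {0<..<L} \<longleftrightarrow> x \<in> {l<..<r}" "Y x = 0 \<longleftrightarrow> x = x0" for x
    using lr by (auto simp: Y_def)
  have contY: "continuous_on S Y" for S
    unfolding Y_def by (intro continuous_intros)
  have derY: "(Y has_real_derivative \<sigma>) (at x)" for x
    unfolding Y_def by (auto intro!: derivative_eq_intros)
  have dp: "1/2 \<le> 1 - \<sigma> * f (Y x)" if "x \<in> {l..r}" for x
    using denom_ge f_bounds Y that by blast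
  have cont_q: "continuous_on {0..L} q" using q' by (rule DERIV_continuous_on)
  have cont_\<rho>: "continuous_on {l..r} \<rho>"
    unfolding \<rho>_def
    by (intro continuous_on_compose2[OF continuous_recip] continuous_on_compose2[OF f(1) contY])
      (use f_bounds Y in auto)
  have cont_E: "continuous_on {l..r} E"
    unfolding E_def by (intro continuous_intros continuous_on_compose2[OF cont_q contY]) (use Y in auto)
  have pos: "0 < \<rho> x" if "x \<in> {l..r}" for x
    using dp[OF that] by (simp add: \<rho>_def recip_def)
  have \<rho>_minus: "\<rho> x - 1 = \<sigma> * f (Y x) * \<rho> x" if "x \<in> {l..r}" for x
    using dp[OF that] by (simp add: \<rho>_def recip_def field_simps)
  have kappa_pos: "0 < potential' \<sigma> (f (Y x))" if "x \<in> {l<..<r}" for x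
    using potential'_bounds(1)[of "f (Y x)"] f_pos[of "Y x"] f_bounds[of "Y x"] Y that by fastforce
  have der_\<rho>: "(\<rho> has_real_derivative \<rho>' x) (at x)" if x: "x \<in> {l<..<r}" for x
  proof -
    have "((\<lambda>x. f (Y x)) has_real_derivative df (Y x) * \<sigma>) (at x)"
      unfolding df_def by (rule DERIV_chain2[OF f' derY]) (use Y x in auto)
    moreover have nz: "1 - \<sigma> * f (Y x) \<noteq> 0" using dp[of x] x by auto
    ultimately have "(\<rho> has_real_derivative - (1 * (0 - \<sigma> * (df (Y x) * \<sigma>))) / (1 - \<sigma> * f (Y x))\<^sup>2) (at x)"
      unfolding \<rho>_def [abs_def] recip_def by (auto intro!: derivative_eq_intros simp: power2_eq_square)
    moreover have "- (1 * (0 - \<sigma> * (df (Y x) * \<sigma>))) = df (Y x)"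
      using sq by (simp add: mult.commute mult.left_commute)
    ultimately have "(\<rho> has_real_derivative df (Y x) / (1 - \<sigma> * f (Y x))\<^sup>2) (at x)"
      by (simp only:)
    then show ?thesis
      by (simp add: \<rho>'_def \<rho>_def recip_def power_one_over)
  qed
  \<comment> \<open>In terms of \<rho> the denominator of the profile equation is
    \<open>\<rho> - 1/\<rho>\<close> up to sign; together with \<open>E_eq\<close> this recovers the
    momentum equation.\<close>
  have pot_eq: "potential' \<sigma> (f (Y x)) = \<sigma> * ((\<rho> x)\<^sup>2 - 1) / \<rho> x" if "x \<in> {l..r}" for x
  proof -
    have "potential' \<sigma> (f (Y x)) = \<sigma> * (\<rho> x - 1 / \<rho> x)"
      by (simp add: potential'_def \<rho>_def recip_def)
    also have "\<dots> = \<sigma> * ((\<rho> x)\<^sup>2 - 1) / \<rho> x"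
      using pos[OF that] by (simp add: field_simps power2_eq_square)
    finally show ?thesis .
  qed
  have E_eq: "E x - 1 / (\<tau> * \<rho> x) = \<sigma> * (f (Y x) / \<tau> - q (Y x))" if "x \<in> {l..r}" for x
    using dp[OF that] tau by (simp add: E_def \<rho>_def recip_def field_simps)
  have "l < r" using lr L by auto
  have "solves_on_piece b \<tau> l r \<rho> E"
  proof (rule solves_on_pieceI[OF \<open>l < r\<close> cont_\<rho> cont_E pos])
    fix x assume x: "x \<in> {l<..<r}"
    then have x': "x \<in> {l..r}" by simp
    have nz: "\<rho> x - 1 \<noteq> 0" "\<rho> x \<noteq> 0" "\<rho> x + 1 \<noteq> 0"
      using pos[OF x'] \<rho>_minus[OF x'] f_pos[of "Y x"] Y x sigma by auto
    have "((\<lambda>x. (\<rho> x - 1)\<^sup>2) has_real_derivative 2 * (\<rho> x - 1) * \<rho>' x) (at x)"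
      by (auto intro!: derivative_eq_intros der_\<rho>[OF x])
    moreover have "2 * (\<rho> x - 1) * \<rho>' x = 2 * \<rho> x ^ 3 / (\<rho> x + 1) * (E x - 1 / (\<tau> * \<rho> x))"
    proof -
      have fac: "(\<rho> x)\<^sup>2 - 1 = (\<rho> x - 1) * (\<rho> x + 1)" by (simp add: algebra_simps power2_eq_square)
      have "df (Y x) = (f (Y x) / \<tau> - q (Y x)) * \<sigma> * \<rho> x / ((\<rho> x - 1) * (\<rho> x + 1))"
      proof -
        have "a / (\<sigma> * c / \<rho> x) = a * \<sigma> * \<rho> x / c" for a c
          using sigma by auto
        then show ?thesis unfolding df_def pot_eq[OF x'] fac .
      qed
      moreover have "2 * m * ((\<rho> x)\<^sup>2 * (a * \<sigma> * \<rho> x / (m * n))) = 2 * \<rho> x ^ 3 / n * (\<sigma> * a)"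
        if "m \<noteq> 0" "n \<noteq> 0" for m n a
        using that by (simp add: power3_eq_cube power2_eq_square)
      ultimately show ?thesis
        unfolding \<rho>'_def E_eq[OF x'] using nz by (simp only: not_False_eq_True)
    qed
    ultimately show "((\<lambda>x. (\<rho> x - 1)\<^sup>2) has_real_derivative 2 * \<rho> x ^ 3 / (\<rho> x + 1) * (E x - 1 / (\<tau> * \<rho> x))) (at x)"
      by simp
    have "((\<lambda>x. q (Y x)) has_real_derivative (b - recip \<sigma> (f (Y x))) * \<sigma>) (at x)"
      by (rule DERIV_chain2[OF _ derY]) (use q'[of "Y x"] Y[of x] x in \<open>auto simp: at_within_Icc_at\<close>)
    then have "(E has_real_derivative 0 - \<sigma> * ((b - recip \<sigma> (f (Y x))) * \<sigma>)) (at x)"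
      unfolding E_def [abs_def] by (intro DERIV_diff DERIV_cmult DERIV_const)
    moreover have "0 - \<sigma> * ((b - recip \<sigma> (f (Y x))) * \<sigma>) = \<rho> x - b"
    proof -
      have "0 - \<sigma> * (c * \<sigma>) = - c" for c using sigma by auto
      then show ?thesis by (simp only: \<rho>_def minus_diff_eq)
    qed
    ultimately show "(E has_real_derivative \<rho> x - b) (at x)" by simp
  qed (use tau in auto)
  moreover have Yl: "filterlim Y (at_right 0) (at x0 within {l..r})"
    unfolding filterlim_at
  proof
    have "(Y \<longlongrightarrow> Y x0) (at x0 within {l..r})"
      using contY[of UNIV] by (simp add: continuous_on_eq_continuous_at isCont_def tendsto_within_subset[of Y _ _ UNIV])
    then show "(Y \<longlongrightarrow> 0) (at x0 within {l..r})" by (simp add: Y_def)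
    show "\<forall>\<^sub>F x in at x0 within {l..r}. Y x \<in> {0<..} \<and> Y x \<noteq> 0"
      unfolding eventually_at_filter
    proof (intro always_eventually allI impI)
      fix x assume "x \<noteq> x0" "x \<in> {l..r}"
      with Y(1,3)[of x] have "Y x \<in> {0..L}" "Y x \<noteq> 0" by simp_all
      then show "Y x \<in> {0<..} \<and> Y x \<noteq> 0" by simp
    qed
  qed
  have x0: "x0 \<in> {l..r}" using lr L by auto
  have lim_\<rho>: "(\<rho> \<longlongrightarrow> 1) (at x0 within {l..r})"
    using cont_\<rho>[unfolded continuous_on_def] x0 f(2) Y(3)[of x0] by (force simp: \<rho>_def recip_def)
  \<comment> \<open>Since \<open>\<rho> - 1 = \<sigma> * f * \<rho>\<close>, the difference quotient
    at \<open>x0\<close> is \<open>f (Y x) / Y x * \<rho> x\<close>, which tends to the smaller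
    root.\<close>
  have 1: "(\<rho> has_real_derivative slope) (at x0 within {l..r})"
    unfolding has_field_derivative_iff
  proof (rule Lim_transform_eventually)
    show "((\<lambda>x. f (Y x) / Y x * \<rho> x) \<longlongrightarrow> slope) (at x0 within {l..r})"
      using tendsto_mult[OF filterlim_compose[OF lim Yl] lim_\<rho>] by simp
    show "\<forall>\<^sub>F x in at x0 within {l..r}. f (Y x) / Y x * \<rho> x = (\<rho> x - \<rho> x0) / (x - x0)"
      unfolding eventually_at_filter
    proof (intro always_eventually allI impI)
      fix x assume "x \<noteq> x0" "x \<in> {l..r}"
      moreover have "\<rho> x0 = 1" using f(2) by (simp add: \<rho>_def Y_def recip_def)
      moreover have "\<sigma> * c * d / e = c / (\<sigma> * e) * d" for c d e :: real using sigma by auto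
      ultimately show "f (Y x) / Y x * \<rho> x = (\<rho> x - \<rho> x0) / (x - x0)"
        using \<rho>_minus[of x] by (simp add: Y_def)
    qed
  qed
  have 2: "(\<rho>' \<longlongrightarrow> slope) (at x0 within {l..r})"
    unfolding \<rho>'_def [abs_def] df_def
    using tendsto_mult[OF tendsto_power[OF lim_\<rho>, of 2] filterlim_compose[OF lim' Yl]] by simp
  have 3: "continuous_on {l<..<r} \<rho>'"
  proof -
    have sub: "continuous_on {l<..<r} \<rho>" "continuous_on {l<..<r} (\<lambda>x. f (Y x))" "continuous_on {l<..<r} (\<lambda>x. q (Y x))"
      using continuous_on_subset[OF cont_\<rho>, of "{l<..<r}"]
        continuous_on_compose2[OF f(1) contY, of "{l<..<r}"] continuous_on_compose2[OF cont_q contY, of "{l<..<r}"] Y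
      by fastforce+
    have "continuous_on {l<..<r} (\<lambda>x. potential' \<sigma> (f (Y x)))"
      unfolding potential'_def using sub(1,2) by (intro continuous_intros) (simp_all add: \<rho>_def)
    then show ?thesis
      unfolding \<rho>'_def df_def using kappa_pos tau by (intro continuous_intros sub) force+
  qed
  have 4: "0 < \<rho> x \<and> 0 < \<sigma> * (\<rho> x - 1)" if x: "x \<in> {l<..<r}" for x
  proof -
    have x': "x \<in> {l..r}" using x by simp
    have "\<sigma> * (\<rho> x - 1) = f (Y x) * \<rho> x"
      unfolding \<rho>_minus[OF x'] using sq by (simp flip: mult.assoc)
    then show ?thesis using pos[OF x'] f_pos[of "Y x"] Y x by simp
  qed
  have "\<rho> l = 1" "\<rho> r = 1" "E x0 = 1 / \<tau>"
    using lr f(2,3) q0 by (auto simp: \<rho>_def Y_def E_def recip_def)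
  with calculation show ?thesis
    using that cont_\<rho> 4 der_\<rho> 3 1 2 by blast
qed

end

section \<open>Gluing the two pieces\<close>

lemma at_within_Icc_union:
  fixes a c d :: real
  assumes "a < c" "c < d"
  shows "at c = sup (at c within {a..c}) (at c within {c..d})"
proof -
  have "at c = at c within {a..d}" using assms by (simp add: at_within_Icc_at)
  also have "{a..d} = {a..c} \<union> {c..d}" using assms by auto
  finally show ?thesis by (simp add: at_within_union)
qed

text \<open>A supersonic profile of length \<open>x0\<close> is glued to a subsonic one of length
  \<open>1 - x0\<close>. Their common value 1 and common slope \<open>s\<close> at
  \<open>x0\<close>, with derivatives tending to \<open>s\<close> from both sides, give continuous
  differentiability. The strict inequalities make \<open>x0\<close> recoverable from \<rho>.\<close>

lemma transonic_solution_exists: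
  assumes b: "b > 1" and tau: "0 < \<tau>" "4 * b * \<tau> \<le> 1" "2 * b * \<tau> \<le> (b - 1) / (b + 1)"
    and x0: "0 < x0" "x0 < 1"
  defines "s \<equiv> 1/4 * (1/\<tau> - sqrt (1/\<tau>\<^sup>2 - 8 * (b - 1)))"
  obtains \<rho> \<rho>sup \<rho>sub Esup Esub where
    "\<rho> \<in> extensional {0..1}" "C1_transonic_solution b \<tau> \<rho> x0 \<rho>sup \<rho>sub Esup Esub"
    "\<rho>sup x0 = 1" "\<rho>sub x0 = 1"
    "(\<rho>sup has_real_derivative s) (at x0 within {0..x0})"
    "(\<rho>sub has_real_derivative s) (at x0 within {x0..1})"
    "Esup x0 = 1 / \<tau>" "Esub x0 = 1 / \<tau>"
    "\<And>x. x \<in> {0<..<x0} \<Longrightarrow> \<rho> x < 1" "\<And>x. x \<in> {x0<..<1} \<Longrightarrow> 1 < \<rho> x"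
proof -
  interpret super: profile "-1" b \<tau> x0 by unfold_locales (use assms in auto)
  interpret sub: profile 1 b \<tau> "1 - x0" by unfold_locales (use assms in auto)
  obtain u u' F where u: "solves_on_piece b \<tau> 0 x0 u F" "continuous_on {0..x0} u" "u 0 = 1" "u x0 = 1" "F x0 = 1 / \<tau>"
    and u_less: "\<And>x. x \<in> {0<..<x0} \<Longrightarrow> 0 < u x \<and> 0 < - 1 * (u x - 1)"
    and u': "\<And>x. x \<in> {0<..<x0} \<Longrightarrow> (u has_real_derivative u' x) (at x)"
    and cont_u': "continuous_on {0<..<x0} u'"
    and u'_x0: "(u has_real_derivative s) (at x0 within {0..x0})" and lim_u': "(u' \<longlongrightarrow> s) (at x0 within {0..x0})"
    unfolding s_def super.slope_def[symmetric] by (rule super.transonic_piece[of 0 x0 x0]) (simp, blast)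
  obtain v v' G where v: "solves_on_piece b \<tau> x0 1 v G" "continuous_on {x0..1} v" "v x0 = 1" "v 1 = 1" "G x0 = 1 / \<tau>"
    and v_greater: "\<And>x. x \<in> {x0<..<1} \<Longrightarrow> 0 < v x \<and> 0 < 1 * (v x - 1)"
    and v': "\<And>x. x \<in> {x0<..<1} \<Longrightarrow> (v has_real_derivative v' x) (at x)"
    and cont_v': "continuous_on {x0<..<1} v'"
    and v'_x0: "(v has_real_derivative s) (at x0 within {x0..1})" and lim_v': "(v' \<longlongrightarrow> s) (at x0 within {x0..1})"
    unfolding s_def sub.slope_def[symmetric] by (rule sub.transonic_piece[of x0 x0 1]) (simp, blast)
  \<comment> \<open>Fixing the value off \<open>{0..1}\<close> makes \<rho> extensional, so
    solutions count as different only if they differ on \<open>{0..1}\<close>.\<close>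
  define \<rho> where "\<rho> x = (if x \<in> {0..1} then if x \<le> x0 then u x else v x else undefined)" for x
  define D where "D x = (if x < x0 then u' x else if x = x0 then s else v' x)" for x
  have \<rho>_u: "\<rho> x = u x" if "x \<in> {0..x0}" for x using that x0 by (auto simp: \<rho>_def)
  have \<rho>_v: "\<rho> x = v x" if "x \<in> {x0..1}" for x using that x0 u(4) v(3) by (auto simp: \<rho>_def)
  note at_x0 = at_within_Icc_union[OF x0]
  have der: "(\<rho> has_real_derivative D x) (at x)" if x: "x \<in> {0<..<1}" for x
  proof -
    consider "x \<in> {0<..<x0}" | "x = x0" | "x \<in> {x0<..<1}" using x by fastforce
    then show ?thesis
    proof cases
      case 1
      then show ?thesis
        using has_field_derivative_transform_within_open[OF u'[OF 1] open_greaterThanLessThan 1, of \<rho>] \<rho>_u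
        by (simp add: D_def)
    next
      case 2
      have "(\<rho> has_real_derivative s) (at x0 within {0..x0})"
        by (rule has_field_derivative_transform_within[OF u'_x0 zero_less_one]) (use \<rho>_u x0 in auto)
      moreover have "(\<rho> has_real_derivative s) (at x0 within {x0..1})"
        by (rule has_field_derivative_transform_within[OF v'_x0 zero_less_one]) (use \<rho>_v x0 in auto)
      ultimately have "(\<rho> has_real_derivative s) (at x0)"
        unfolding has_field_derivative_iff by (simp add: at_x0 filterlim_sup)
      then show ?thesis using 2 by (simp add: D_def)
    next
      case 3
      then show ?thesis
        using has_field_derivative_transform_within_open[OF v'[OF 3] open_greaterThanLessThan 3, of \<rho>] \<rho>_v
        by (simp add: D_def)
    qed
  qed
  have cont_D: "continuous_on {0<..<1} D"
  proof (intro continuous_at_imp_continuous_on ballI)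
    fix x :: real assume "x \<in> {0<..<1}"
    then consider "x \<in> {0<..<x0}" | "x = x0" | "x \<in> {x0<..<1}" by fastforce
    then show "isCont D x"
    proof cases
      case 1
      have "continuous_on {0<..<x0} D"
        using cont_u' by (rule continuous_on_eq) (simp add: D_def)
      with 1 show ?thesis using continuous_on_eq_continuous_at open_greaterThanLessThan by blast
    next
      case 2
      have "(D \<longlongrightarrow> s) (at x0 within {0..x0})"
        by (rule Lim_transform_eventually[OF lim_u'])
          (auto simp: eventually_at_filter D_def intro: always_eventually)
      moreover have "(D \<longlongrightarrow> s) (at x0 within {x0..1})"
        by (rule Lim_transform_eventually[OF lim_v'])
          (auto simp: eventually_at_filter D_def intro: always_eventually)
      ultimately have "(D \<longlongrightarrow> s) (at x0)"
        by (simp add: at_x0 filterlim_sup)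
      then show ?thesis
        using 2 by (simp add: continuous_within D_def)
    next
      case 3
      have "continuous_on {x0<..<1} D"
        using cont_v' by (rule continuous_on_eq) (simp add: D_def)
      with 3 show ?thesis using continuous_on_eq_continuous_at open_greaterThanLessThan by blast
    qed
  qed
  have "continuous_on ({0..x0} \<union> {x0..1}) \<rho>"
    using continuous_on_eq[OF u(2)] continuous_on_eq[OF v(2)] \<rho>_u \<rho>_v
    by (intro continuous_on_closed_Un) auto
  moreover have "{0..x0} \<union> {x0..1} = {0..1}" using x0 by auto
  ultimately have cont_\<rho>: "continuous_on {0..1} \<rho>" by simp
  have "\<rho> C1_differentiable_on {0<..<1}"
    unfolding C1_differentiable_on_def using der cont_D
    by (intro exI[of _ D]) (simp flip: has_real_derivative_iff_has_vector_derivative)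
  moreover have "\<forall>x\<in>{0<..<1}. 0 < \<rho> x"
  proof
    fix x :: real assume "x \<in> {0<..<1}"
    then consider "x \<in> {0<..<x0}" | "x = x0" | "x \<in> {x0<..<1}" by fastforce
    then show "0 < \<rho> x"
      by cases (use u_less v_greater \<rho>_u \<rho>_v u(4) x0 in auto)
  qed
  ultimately have sol: "C1_transonic_solution b \<tau> \<rho> x0 u v F G"
    unfolding C1_transonic_solution_def
  proof (intro conjI ballI exI[of _ s])
    show "\<rho> 0 = 1" "\<rho> 1 = 1" using \<rho>_u[of 0] \<rho>_v[of 1] u(3) v(4) x0 by simp_all
    show "x0 \<in> {0<..<1}" "u x0 = v x0" using x0 u(4) v(3) by simp_all
    show "\<rho> x = u x" "0 < u x" "u x \<le> 1" if "x \<in> {0<..<x0}" for x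
      using \<rho>_u[of x] u_less[OF that] that by simp_all
    show "\<rho> x = v x" "1 \<le> v x" if "x \<in> {x0<..<1}" for x
      using \<rho>_v[of x] v_greater[OF that] that by simp_all
  qed (use cont_\<rho> u(1) v(1) u'_x0 v'_x0 in auto)
  show ?thesis
  proof (rule that[OF _ sol])
    show "\<rho> \<in> extensional {0..1}" by (simp add: extensional_def \<rho>_def)
    show "\<rho> x < 1" if "x \<in> {0<..<x0}" for x using u_less[OF that] \<rho>_u[of x] that by simp
    show "1 < \<rho> x" if "x \<in> {x0<..<1}" for x using v_greater[OF that] \<rho>_v[of x] that by simp
  qed (fact u v u'_x0 v'_x0)+
qed

theorem theorem2p6:
  fixes b :: real
  assumes "b > 1"
  shows "\<exists>\<tau>0>0. \<forall>\<tau>. 0 < \<tau> \<and> \<tau> < \<tau>0 \<longrightarrow>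
    infinite {\<rho> \<in> extensional {0..1}.
      \<exists>x0 \<rho>sup \<rho>sub Esup Esub.
        C1_transonic_solution b \<tau> \<rho> x0 \<rho>sup \<rho>sub Esup Esub \<and>
        \<rho>sup x0 = 1 \<and> \<rho>sub x0 = 1 \<and>
        (\<rho>sup has_real_derivative (1/4 * (1/\<tau> - sqrt (1/\<tau>\<^sup>2 - 8 * (b - 1))))) (at x0 within {0..x0}) \<and>
        (\<rho>sub has_real_derivative (1/4 * (1/\<tau> - sqrt (1/\<tau>\<^sup>2 - 8 * (b - 1))))) (at x0 within {x0..1}) \<and>
        Esup x0 = 1/\<tau> \<and> Esub x0 = 1/\<tau>}"
proof (intro exI conjI allI impI)
  \<comment> \<open>The two terms encode the two smallness conditions on \<tau> in the locale
    \<open>profile\<close>.\<close>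
  define \<tau>0 where "\<tau>0 = min (1 / (4 * b)) ((b - 1) / (b + 1) / (2 * b))"
  show "0 < \<tau>0" using assms by (simp add: \<tau>0_def)
  fix \<tau> assume tau: "0 < \<tau> \<and> \<tau> < \<tau>0"
  have 1: "4 * b * \<tau> \<le> 1" "2 * b * \<tau> \<le> (b - 1) / (b + 1)"
  proof -
    have "\<tau> * (4 * b) < 1"
      by (rule pos_less_divide_eq[THEN iffD1]) (use assms tau in \<open>simp_all add: \<tau>0_def\<close>)
    moreover have "\<tau> * (2 * b) < (b - 1) / (b + 1)"
      by (rule pos_less_divide_eq[THEN iffD1]) (use assms tau in \<open>simp_all add: \<tau>0_def\<close>)
    ultimately show "4 * b * \<tau> \<le> 1" "2 * b * \<tau> \<le> (b - 1) / (b + 1)" by (simp_all only: mult.commute less_imp_le)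
  qed
  define S where "S = {\<rho> \<in> extensional {0..1}.
      \<exists>x0 \<rho>sup \<rho>sub Esup Esub.
        C1_transonic_solution b \<tau> \<rho> x0 \<rho>sup \<rho>sub Esup Esub \<and>
        \<rho>sup x0 = 1 \<and> \<rho>sub x0 = 1 \<and>
        (\<rho>sup has_real_derivative (1/4 * (1/\<tau> - sqrt (1/\<tau>\<^sup>2 - 8 * (b - 1))))) (at x0 within {0..x0}) \<and>
        (\<rho>sub has_real_derivative (1/4 * (1/\<tau> - sqrt (1/\<tau>\<^sup>2 - 8 * (b - 1))))) (at x0 within {x0..1}) \<and>
        Esup x0 = 1/\<tau> \<and> Esub x0 = 1/\<tau>}"
  have "\<exists>\<rho>. \<rho> \<in> S \<and> (\<forall>x\<in>{0<..<x0}. \<rho> x < 1) \<and> (\<forall>x\<in>{x0<..<1}. 1 < \<rho> x)"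
    if x0: "x0 \<in> {0<..<1}" for x0
  proof -
    have "0 < x0" "x0 < 1" using x0 by auto
    from assms conjunct1[OF tau] 1 this show ?thesis
      by (rule transonic_solution_exists) (unfold S_def, blast)
  qed
  then obtain R where R: "\<And>x0. x0 \<in> {0<..<1} \<Longrightarrow> R x0 \<in> S"
    "\<And>x0 x. x0 \<in> {0<..<1} \<Longrightarrow> x \<in> {0<..<x0} \<Longrightarrow> R x0 x < 1"
    "\<And>x0 x. x0 \<in> {0<..<1} \<Longrightarrow> x \<in> {x0<..<1} \<Longrightarrow> 1 < R x0 x"
    by metis
  have "inj_on R {0<..<1}"
  proof (rule linorder_inj_onI')
    fix x y :: real assume xy: "x \<in> {0<..<1}" "y \<in> {0<..<1}" "x < y"
    \<comment> \<open>The midpoint is subsonic for the transition at \<open>x\<close> and supersonic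
      for the one at \<open>y\<close>.\<close>
    then have "1 < R x ((x + y) / 2)" "R y ((x + y) / 2) < 1"
      by (auto intro!: R(2,3))
    then show "R x \<noteq> R y" by auto
  qed
  then have "infinite (R ` {0<..<1})"
    by (simp add: finite_image_iff infinite_Ioo)
  moreover have "R ` {0<..<1} \<subseteq> S" using R(1) by blast
  ultimately have "infinite S" using infinite_super by blast
  then show "infinite {\<rho> \<in> extensional {0..1}.
      \<exists>x0 \<rho>sup \<rho>sub Esup Esub.
        C1_transonic_solution b \<tau> \<rho> x0 \<rho>sup \<rho>sub Esup Esub \<and>
        \<rho>sup x0 = 1 \<and> \<rho>sub x0 = 1 \<and>
        (\<rho>sup has_real_derivative (1/4 * (1/\<tau> - sqrt (1/\<tau>\<^sup>2 - 8 * (b - 1))))) (at x0 within {0..x0}) \<and>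
        (\<rho>sub has_real_derivative (1/4 * (1/\<tau> - sqrt (1/\<tau>\<^sup>2 - 8 * (b - 1))))) (at x0 within {x0..1}) \<and>
        Esup x0 = 1/\<tau> \<and> Esub x0 = 1/\<tau>}"
    unfolding S_def .
qed

end
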